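(* Let $(A,\mu,1_A,\alpha)$ be a Hom-algebra over a field $k$ and let $\lambda,\nu\in k$. Then the linear map $$B: A\otimes A\to A\otimes A,\qquad a\otimes b\mapsto \lambda\, ab\otimes 1_A+\nu\, 1_A\otimes ab-\lambda\,\alpha(a)\otimes\alpha(b)$$ is a solution of the Hom-Yang-Baxter equation (with respect to the twist map $\alpha$ on $A$).
   Context: Throughout, $k$ is a fixed field; vector spaces, linear maps and tensor products are over $k$. A Hom-algebra is a quadruple $(A,\mu,1_A,\alpha)$ where $A$ is a $k$-linear space, $\mu:A\otimes A\to A$ is a $k$-linear map (written $\mu(a\otimes a')=aa'$), $1_A\in A$, and $\alpha:A\to A$ is a linear endomorphism, such that for all $a,a',a''\in A$: $\alpha(aa')=\alpha(a)\alpha(a')$, $\alpha(1_A)=1_A$, $\alpha(a)(a'a'')=(aa')\alpha(a'')$, and $a1_A=1_Aa=\alpha(a)$. Hom-Yang-Baxter equation (HYBE): given a vector space $V$ and a linear endomorphism $\alpha$ of $V$, a linear map $B:V\otimes V\to V\otimes V$ is a solution of the HYBE if $B$ commutes with $\alpha\otimes\alpha$, i.e. $(\alpha\otimes\alpha)\circ B=B\circ(\alpha\otimes\alpha)$, and $$(\alpha\otimes B)\circ(B\otimes\alpha)\circ(\alpha\otimes B)=(B\otimes\alpha)\circ(\alpha\otimes B)\circ(B\otimes\alpha)$$ as maps $V\otimes V\otimes V\to V\otimes V\otimes V$. *)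

theory Defs
  imports "HOL-Algebra.Module" "HOL-Algebra.QuotRing"
begin

section \<open>Linear and bilinear maps\<close>

text \<open>
  A vector space over a field \<open>K\<close> is a \<open>module K V\<close> with \<open>field K\<close>.  The type \<open>module\<close> extends
  \<open>ring\<close>; the ring multiplication and the ring unit of such a record are ignored throughout.
  Maps are only constrained on carriers, and accordingly are only compared on carriers.
\<close>

definition lin_maps ::
  "('k, 'm) ring_scheme \<Rightarrow> ('k, 'v, 'a) module_scheme \<Rightarrow> ('k, 'w, 'b) module_scheme \<Rightarrow> ('v \<Rightarrow> 'w) set"
  where "lin_maps K V W =
    {f \<in> carrier V \<rightarrow> carrier W.
       (\<forall>x\<in>carrier V. \<forall>y\<in>carrier V. f (x \<oplus>\<^bsub>V\<^esub> y) = f x \<oplus>\<^bsub>W\<^esub> f y) \<and>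
       (\<forall>c\<in>carrier K. \<forall>x\<in>carrier V. f (c \<odot>\<^bsub>V\<^esub> x) = c \<odot>\<^bsub>W\<^esub> f x)}"

definition bilinear ::
  "('k, 'm) ring_scheme \<Rightarrow> ('k, 'v, 'a) module_scheme \<Rightarrow> ('k, 'w, 'b) module_scheme \<Rightarrow>
   ('k, 'u, 'c) module_scheme \<Rightarrow> ('v \<Rightarrow> 'w \<Rightarrow> 'u) \<Rightarrow> bool"
  where "bilinear K V W U f \<longleftrightarrow>
    (\<forall>v\<in>carrier V. f v \<in> lin_maps K W U) \<and> (\<forall>w\<in>carrier W. (\<lambda>v. f v w) \<in> lin_maps K V U)"

section \<open>Tensor products\<close>

definition free_module :: "('k, 'm) ring_scheme \<Rightarrow> 'x set \<Rightarrow> ('k, 'x \<Rightarrow> 'k) module"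
  where "free_module K S =
    \<lparr> carrier = {p. (\<forall>x. p x \<in> carrier K) \<and> (\<forall>x. x \<notin> S \<longrightarrow> p x = \<zero>\<^bsub>K\<^esub>) \<and> finite {x. p x \<noteq> \<zero>\<^bsub>K\<^esub>}},
      mult = undefined, one = undefined,
      zero = (\<lambda>x. \<zero>\<^bsub>K\<^esub>), add = (\<lambda>p q x. p x \<oplus>\<^bsub>K\<^esub> q x),
      smult = (\<lambda>c p x. c \<otimes>\<^bsub>K\<^esub> p x) \<rparr>"

definition basis_elem :: "('k, 'm) ring_scheme \<Rightarrow> 'x \<Rightarrow> ('x \<Rightarrow> 'k)"
  where "basis_elem K s = (\<lambda>x. if x = s then \<one>\<^bsub>K\<^esub> else \<zero>\<^bsub>K\<^esub>)"

definition quot_module :: "('k, 'v, 'a) module_scheme \<Rightarrow> 'v set \<Rightarrow> ('k, 'v set) module"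
  where "quot_module M N =
    \<lparr> carrier = a_rcosets\<^bsub>M\<^esub> N,
      mult = undefined, one = undefined,
      zero = N, add = (\<lambda>X Y. X <+>\<^bsub>M\<^esub> Y),
      smult = (\<lambda>c X. \<Union>x\<in>X. N +>\<^bsub>M\<^esub> (c \<odot>\<^bsub>M\<^esub> x)) \<rparr>"

definition tensor_relations ::
  "('k, 'm) ring_scheme \<Rightarrow> ('k, 'v, 'a) module_scheme \<Rightarrow> ('k, 'w, 'b) module_scheme \<Rightarrow> ('v \<times> 'w \<Rightarrow> 'k) set"
  where "tensor_relations K V W =
    (let F = free_module K (carrier V \<times> carrier W); e = (\<lambda>v w. basis_elem K (v, w)) in
      {e (v \<oplus>\<^bsub>V\<^esub> v') w \<ominus>\<^bsub>F\<^esub> (e v w \<oplus>\<^bsub>F\<^esub> e v' w) | v v' w.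
         v \<in> carrier V \<and> v' \<in> carrier V \<and> w \<in> carrier W} \<union>
      {e v (w \<oplus>\<^bsub>W\<^esub> w') \<ominus>\<^bsub>F\<^esub> (e v w \<oplus>\<^bsub>F\<^esub> e v w') | v w w'.
         v \<in> carrier V \<and> w \<in> carrier W \<and> w' \<in> carrier W} \<union>
      {e (c \<odot>\<^bsub>V\<^esub> v) w \<ominus>\<^bsub>F\<^esub> (c \<odot>\<^bsub>F\<^esub> e v w) | c v w.
         c \<in> carrier K \<and> v \<in> carrier V \<and> w \<in> carrier W} \<union>
      {e v (c \<odot>\<^bsub>W\<^esub> w) \<ominus>\<^bsub>F\<^esub> (c \<odot>\<^bsub>F\<^esub> e v w) | c v w.
         c \<in> carrier K \<and> v \<in> carrier V \<and> w \<in> carrier W})"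

definition tensor_null ::
  "('k, 'm) ring_scheme \<Rightarrow> ('k, 'v, 'a) module_scheme \<Rightarrow> ('k, 'w, 'b) module_scheme \<Rightarrow> ('v \<times> 'w \<Rightarrow> 'k) set"
  where "tensor_null K V W =
    \<Inter>{N. submodule N K (free_module K (carrier V \<times> carrier W)) \<and> tensor_relations K V W \<subseteq> N}"

definition tensor ::
  "('k, 'm) ring_scheme \<Rightarrow> ('k, 'v, 'a) module_scheme \<Rightarrow> ('k, 'w, 'b) module_scheme \<Rightarrow>
   ('k, ('v \<times> 'w \<Rightarrow> 'k) set) module"
  where "tensor K V W =
    quot_module (free_module K (carrier V \<times> carrier W)) (tensor_null K V W)"

definition pure_tensor ::
  "('k, 'm) ring_scheme \<Rightarrow> ('k, 'v, 'a) module_scheme \<Rightarrow> ('k, 'w, 'b) module_scheme \<Rightarrow>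
   'v \<Rightarrow> 'w \<Rightarrow> ('v \<times> 'w \<Rightarrow> 'k) set"
  where "pure_tensor K V W v w =
    tensor_null K V W +>\<^bsub>free_module K (carrier V \<times> carrier W)\<^esub> basis_elem K (v, w)"

text \<open>
  The linear map on the tensor product induced by a bilinear map; it is well defined by
  \<open>tensor_universal\<close> below.
\<close>

definition tensor_lift ::
  "('k, 'm) ring_scheme \<Rightarrow> ('k, 'v, 'a) module_scheme \<Rightarrow> ('k, 'w, 'b) module_scheme \<Rightarrow>
   ('k, 'u, 'c) module_scheme \<Rightarrow> ('v \<Rightarrow> 'w \<Rightarrow> 'u) \<Rightarrow> ('v \<times> 'w \<Rightarrow> 'k) set \<Rightarrow> 'u"
  where "tensor_lift K V W U f =
    (THE h. h \<in> lin_maps K (tensor K V W) U \<and> h \<in> extensional (carrier (tensor K V W)) \<and>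
            (\<forall>v\<in>carrier V. \<forall>w\<in>carrier W. h (pure_tensor K V W v w) = f v w))"

definition tensor_map ::
  "('k, 'm) ring_scheme \<Rightarrow> ('k, 'v, 'a) module_scheme \<Rightarrow> ('k, 'w, 'b) module_scheme \<Rightarrow>
   ('k, 'v2, 'c) module_scheme \<Rightarrow> ('k, 'w2, 'd) module_scheme \<Rightarrow>
   ('v \<Rightarrow> 'v2) \<Rightarrow> ('w \<Rightarrow> 'w2) \<Rightarrow> ('v \<times> 'w \<Rightarrow> 'k) set \<Rightarrow> ('v2 \<times> 'w2 \<Rightarrow> 'k) set"
  where "tensor_map K V W V' W' f g =
    tensor_lift K V W (tensor K V' W') (\<lambda>v w. pure_tensor K V' W' (f v) (g w))"

text \<open>
  The canonical isomorphism \<open>(U \<otimes> V) \<otimes> W \<rightarrow> U \<otimes> (V \<otimes> W)\<close>, \<open>(u \<otimes> v) \<otimes> w \<mapsto> u \<otimes> (v \<otimes> w)\<close>, and its inverse.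
\<close>

definition tensor_assoc ::
  "('k, 'm) ring_scheme \<Rightarrow> ('k, 'u, 'a) module_scheme \<Rightarrow> ('k, 'v, 'b) module_scheme \<Rightarrow>
   ('k, 'w, 'c) module_scheme \<Rightarrow>
   (('u \<times> 'v \<Rightarrow> 'k) set \<times> 'w \<Rightarrow> 'k) set \<Rightarrow> ('u \<times> ('v \<times> 'w \<Rightarrow> 'k) set \<Rightarrow> 'k) set"
  where "tensor_assoc K U V W =
    (let VW = tensor K V W; T = tensor K U VW in
      tensor_lift K (tensor K U V) W T
        (\<lambda>t w. tensor_lift K U V T (\<lambda>u v. pure_tensor K U VW u (pure_tensor K V W v w)) t))"

definition tensor_assoc_inv ::
  "('k, 'm) ring_scheme \<Rightarrow> ('k, 'u, 'a) module_scheme \<Rightarrow> ('k, 'v, 'b) module_scheme \<Rightarrow>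
   ('k, 'w, 'c) module_scheme \<Rightarrow>
   ('u \<times> ('v \<times> 'w \<Rightarrow> 'k) set \<Rightarrow> 'k) set \<Rightarrow> (('u \<times> 'v \<Rightarrow> 'k) set \<times> 'w \<Rightarrow> 'k) set"
  where "tensor_assoc_inv K U V W =
    (let UV = tensor K U V; T = tensor K UV W in
      tensor_lift K U (tensor K V W) T
        (\<lambda>u. tensor_lift K V W T (\<lambda>v w. pure_tensor K UV W (pure_tensor K U V u v) w)))"

section \<open>Hom-algebras and the Hom-Yang-Baxter equation\<close>

locale hom_algebra = field K + module K A
  for K :: "('k, 'm) ring_scheme" (structure) and A :: "('k, 'a, 'n) module_scheme" (structure) +
  fixes \<mu> :: "('a \<times> 'a \<Rightarrow> 'k) set \<Rightarrow> 'a" and unit :: 'a and \<alpha> :: "'a \<Rightarrow> 'a"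
  assumes mu_linear: "\<mu> \<in> lin_maps K (tensor K A A) A"
    and unit_closed: "unit \<in> carrier A"
    and alpha_linear: "\<alpha> \<in> lin_maps K A A"
    and alpha_mult: "\<lbrakk>a \<in> carrier A; b \<in> carrier A\<rbrakk> \<Longrightarrow>
      \<alpha> (\<mu> (pure_tensor K A A a b)) = \<mu> (pure_tensor K A A (\<alpha> a) (\<alpha> b))"
    and alpha_unit: "\<alpha> unit = unit"
    and hom_assoc: "\<lbrakk>a \<in> carrier A; b \<in> carrier A; c \<in> carrier A\<rbrakk> \<Longrightarrow>
      \<mu> (pure_tensor K A A (\<alpha> a) (\<mu> (pure_tensor K A A b c))) =
      \<mu> (pure_tensor K A A (\<mu> (pure_tensor K A A a b)) (\<alpha> c))"
    and mult_unit_right: "a \<in> carrier A \<Longrightarrow> \<mu> (pure_tensor K A A a unit) = \<alpha> a"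
    and mult_unit_left: "a \<in> carrier A \<Longrightarrow> \<mu> (pure_tensor K A A unit a) = \<alpha> a"

text \<open>
  Threefold tensors are represented in \<open>(V \<otimes> V) \<otimes> V\<close>; the map \<open>\<alpha> \<otimes> B\<close>, which naturally lives on
  \<open>V \<otimes> (V \<otimes> V)\<close>, is transported along the associativity isomorphism.
\<close>

definition hybe_solution ::
  "('k, 'm) ring_scheme \<Rightarrow> ('k, 'v, 'a) module_scheme \<Rightarrow> ('v \<Rightarrow> 'v) \<Rightarrow>
   (('v \<times> 'v \<Rightarrow> 'k) set \<Rightarrow> ('v \<times> 'v \<Rightarrow> 'k) set) \<Rightarrow> bool"
  where "hybe_solution K V \<alpha> B \<longleftrightarrow>
    (let VV = tensor K V V;
         \<alpha>\<alpha> = tensor_map K V V V V \<alpha> \<alpha>;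
         B\<alpha> = tensor_map K VV V VV V B \<alpha>;
         \<alpha>B = tensor_assoc_inv K V V V \<circ> tensor_map K V VV V VV \<alpha> B \<circ> tensor_assoc K V V V
     in B \<in> lin_maps K VV VV \<and>
        (\<forall>x\<in>carrier VV. (\<alpha>\<alpha> \<circ> B) x = (B \<circ> \<alpha>\<alpha>) x) \<and>
        (\<forall>x\<in>carrier (tensor K VV V). (\<alpha>B \<circ> B\<alpha> \<circ> \<alpha>B) x = (B\<alpha> \<circ> \<alpha>B \<circ> B\<alpha>) x))"

text \<open>
  \<open>B\<close> is the linear map
  \<open>a \<otimes> b \<mapsto> l (ab \<otimes> 1) + n (1 \<otimes> ab) - l (\<alpha> a \<otimes> \<alpha> b)\<close>; on the carrier of the tensor product this determines \<open>B\<close>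
  by \<open>tensor_hom_ext\<close>.
\<close>

definition is_yb_map ::
  "('k, 'm) ring_scheme \<Rightarrow> ('k, 'a, 'n) module_scheme \<Rightarrow> (('a \<times> 'a \<Rightarrow> 'k) set \<Rightarrow> 'a) \<Rightarrow> 'a \<Rightarrow>
   ('a \<Rightarrow> 'a) \<Rightarrow> 'k \<Rightarrow> 'k \<Rightarrow> (('a \<times> 'a \<Rightarrow> 'k) set \<Rightarrow> ('a \<times> 'a \<Rightarrow> 'k) set) \<Rightarrow> bool"
  where "is_yb_map K A \<mu> unit \<alpha> l n B \<longleftrightarrow>
    (let AA = tensor K A A; t = pure_tensor K A A in
      B \<in> lin_maps K AA AA \<and>
      (\<forall>a\<in>carrier A. \<forall>b\<in>carrier A.
         B (t a b) = l \<odot>\<^bsub>AA\<^esub> t (\<mu> (t a b)) unit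
                       \<oplus>\<^bsub>AA\<^esub> n \<odot>\<^bsub>AA\<^esub> t unit (\<mu> (t a b))
                       \<ominus>\<^bsub>AA\<^esub> l \<odot>\<^bsub>AA\<^esub> t (\<alpha> a) (\<alpha> b)))"

section \<open>Well-definedness of the tensor constructions\<close>

lemma lin_mapsI:
  assumes "\<And>x. x \<in> carrier V \<Longrightarrow> f x \<in> carrier W"
    and "\<And>x y. \<lbrakk>x \<in> carrier V; y \<in> carrier V\<rbrakk> \<Longrightarrow> f (x \<oplus>\<^bsub>V\<^esub> y) = f x \<oplus>\<^bsub>W\<^esub> f y"
    and "\<And>c x. \<lbrakk>c \<in> carrier K; x \<in> carrier V\<rbrakk> \<Longrightarrow> f (c \<odot>\<^bsub>V\<^esub> x) = c \<odot>\<^bsub>W\<^esub> f x"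
  shows "f \<in> lin_maps K V W"
  using assms unfolding lin_maps_def by auto

lemma lin_mapsD:
  assumes "f \<in> lin_maps K V W"
  shows "x \<in> carrier V \<Longrightarrow> f x \<in> carrier W"
    and "\<lbrakk>x \<in> carrier V; y \<in> carrier V\<rbrakk> \<Longrightarrow> f (x \<oplus>\<^bsub>V\<^esub> y) = f x \<oplus>\<^bsub>W\<^esub> f y"
    and "\<lbrakk>c \<in> carrier K; x \<in> carrier V\<rbrakk> \<Longrightarrow> f (c \<odot>\<^bsub>V\<^esub> x) = c \<odot>\<^bsub>W\<^esub> f x"
  using assms unfolding lin_maps_def by auto

lemma lin_map_zero:
  assumes "module K V" "module K W" "f \<in> lin_maps K V W"
  shows "f \<zero>\<^bsub>V\<^esub> = \<zero>\<^bsub>W\<^esub>"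
proof -
  interpret V: module K V by fact
  interpret W: module K W by fact
  have "f (\<zero>\<^bsub>K\<^esub> \<odot>\<^bsub>V\<^esub> \<zero>\<^bsub>V\<^esub>) = \<zero>\<^bsub>K\<^esub> \<odot>\<^bsub>W\<^esub> f \<zero>\<^bsub>V\<^esub>"
    by (rule lin_mapsD(3)[OF assms(3)]) auto
  then show ?thesis using lin_mapsD(1)[OF assms(3) V.zero_closed] by simp
qed

lemma lin_map_uminus:
  assumes "module K V" "module K W" "f \<in> lin_maps K V W" "x \<in> carrier V"
  shows "f (\<ominus>\<^bsub>V\<^esub> x) = \<ominus>\<^bsub>W\<^esub> f x"
proof -
  interpret V: module K V by fact
  interpret W: module K W by fact
  have "f (\<ominus>\<^bsub>V\<^esub> x) \<oplus>\<^bsub>W\<^esub> f x = f (\<ominus>\<^bsub>V\<^esub> x \<oplus>\<^bsub>V\<^esub> x)"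
    using lin_mapsD(2)[OF assms(3)] assms(4) by simp
  also have "\<dots> = \<zero>\<^bsub>W\<^esub>" using assms(4) lin_map_zero[OF assms(1-3)] by (simp add: V.M.l_neg)
  finally show ?thesis
    using lin_mapsD(1)[OF assms(3)] assms(4) by (metis V.M.a_inv_closed W.M.minus_equality)
qed

lemma lin_map_minus:
  assumes "module K V" "module K W" "f \<in> lin_maps K V W" "x \<in> carrier V" "y \<in> carrier V"
  shows "f (x \<ominus>\<^bsub>V\<^esub> y) = f x \<ominus>\<^bsub>W\<^esub> f y"
proof -
  interpret V: module K V by fact
  show ?thesis
    using assms by (simp add: a_minus_def lin_mapsD(2) lin_map_uminus)
qed

lemma lin_maps_eq_submodule:
  assumes "module K V" "module K W" "f \<in> lin_maps K V W" "g \<in> lin_maps K V W"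
  shows "submodule {x \<in> carrier V. f x = g x} K V"
proof -
  interpret V: module K V by fact
  show ?thesis
    by (rule V.submoduleI)
      (use assms in \<open>auto simp: lin_map_zero lin_map_uminus lin_mapsD\<close>)
qed

lemma free_module_simps [simp]:
  "zero (free_module K S) = (\<lambda>x. \<zero>\<^bsub>K\<^esub>)"
  "add (free_module K S) = (\<lambda>p q x. p x \<oplus>\<^bsub>K\<^esub> q x)"
  "smult (free_module K S) = (\<lambda>c p x. c \<otimes>\<^bsub>K\<^esub> p x)"
  by (simp_all add: free_module_def)

lemma free_module_carrier:
  "p \<in> carrier (free_module K S) \<longleftrightarrow>
    (\<forall>x. p x \<in> carrier K) \<and> (\<forall>x. x \<notin> S \<longrightarrow> p x = \<zero>\<^bsub>K\<^esub>) \<and> finite {x. p x \<noteq> \<zero>\<^bsub>K\<^esub>}"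
  by (simp add: free_module_def)

lemma free_module_module:
  assumes "cring K"
  shows "module K (free_module K S)"
proof -
  interpret cring K by fact
  have ag: "abelian_group (free_module K S)"
  proof (rule abelian_groupI)
    fix p q assume pq: "p \<in> carrier (free_module K S)" "q \<in> carrier (free_module K S)"
    have "{x. p x \<oplus>\<^bsub>K\<^esub> q x \<noteq> \<zero>\<^bsub>K\<^esub>} \<subseteq> {x. p x \<noteq> \<zero>\<^bsub>K\<^esub>} \<union> {x. q x \<noteq> \<zero>\<^bsub>K\<^esub>}" by auto
    then show "p \<oplus>\<^bsub>free_module K S\<^esub> q \<in> carrier (free_module K S)"
      using pq by (auto simp: free_module_carrier intro: finite_subset)
    show "p \<oplus>\<^bsub>free_module K S\<^esub> q = q \<oplus>\<^bsub>free_module K S\<^esub> p"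
      using pq by (auto simp: free_module_carrier intro!: ext a_comm)
  next
    fix p assume p: "p \<in> carrier (free_module K S)"
    show "\<exists>q\<in>carrier (free_module K S). q \<oplus>\<^bsub>free_module K S\<^esub> p = \<zero>\<^bsub>free_module K S\<^esub>"
    proof (rule bexI)
      show "(\<lambda>x. \<ominus>\<^bsub>K\<^esub> p x) \<oplus>\<^bsub>free_module K S\<^esub> p = \<zero>\<^bsub>free_module K S\<^esub>"
        using p by (auto simp: free_module_carrier l_neg)
      have "{x. \<ominus>\<^bsub>K\<^esub> p x \<noteq> \<zero>\<^bsub>K\<^esub>} \<subseteq> {x. p x \<noteq> \<zero>\<^bsub>K\<^esub>}" by auto
      then show "(\<lambda>x. \<ominus>\<^bsub>K\<^esub> p x) \<in> carrier (free_module K S)"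
        using p by (auto simp: free_module_carrier intro: finite_subset)
    qed
  qed (auto simp: free_module_carrier a_assoc)
  show ?thesis
  proof (rule moduleI[OF assms ag])
    fix c p assume cp: "c \<in> carrier K" "p \<in> carrier (free_module K S)"
    have "{x. c \<otimes>\<^bsub>K\<^esub> p x \<noteq> \<zero>\<^bsub>K\<^esub>} \<subseteq> {x. p x \<noteq> \<zero>\<^bsub>K\<^esub>}" using cp by auto
    then show "c \<odot>\<^bsub>free_module K S\<^esub> p \<in> carrier (free_module K S)"
      using cp by (auto simp: free_module_carrier intro: finite_subset)
  qed (auto simp: free_module_carrier l_distr r_distr m_assoc)
qed

lemma basis_elem_closed:
  assumes "cring K" "s \<in> S"
  shows "basis_elem K s \<in> carrier (free_module K S)"
proof -
  interpret cring K by fact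
  have "{x. basis_elem K s x \<noteq> \<zero>\<^bsub>K\<^esub>} \<subseteq> {s}" by (auto simp: basis_elem_def)
  then show ?thesis
    using assms(2) by (auto simp: free_module_carrier basis_elem_def intro: finite_subset)
qed

lemma free_module_span:
  assumes K: "cring K" and N: "submodule N K (free_module K S)"
    and b: "\<And>s. s \<in> S \<Longrightarrow> basis_elem K s \<in> N"
    and p: "p \<in> carrier (free_module K S)"
  shows "p \<in> N"
proof -
  interpret cring K by fact
  interpret F: module K "free_module K S" by (rule free_module_module[OF K])
  note sub = F.submoduleE[OF N]
  have z: "(\<lambda>x. \<zero>\<^bsub>K\<^esub>) \<in> N"
    using subgroup.one_closed[OF submodule.axioms(1)[OF N]] by simp
  have "\<And>p. \<lbrakk>p \<in> carrier (free_module K S); {x. p x \<noteq> \<zero>\<^bsub>K\<^esub>} \<subseteq> I\<rbrakk> \<Longrightarrow> p \<in> N"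
    if "finite I" for I
    using that
  proof (induction I rule: finite_induct)
    case empty
    then have "p = (\<lambda>x. \<zero>\<^bsub>K\<^esub>)" by auto
    then show ?case using z by simp
  next
    case (insert i I)
    have pK: "\<And>x. p x \<in> carrier K" using insert.prems by (simp add: free_module_carrier)
    show ?case
    proof (cases "i \<in> S")
      case False
      then have "{x. p x \<noteq> \<zero>\<^bsub>K\<^esub>} \<subseteq> I" using insert.prems by (auto simp: free_module_carrier)
      then show ?thesis using insert.IH insert.prems by blast
    next
      case True
      define q where "q = p(i := \<zero>\<^bsub>K\<^esub>)"
      have qs: "{x. q x \<noteq> \<zero>\<^bsub>K\<^esub>} \<subseteq> I" using insert.prems by (auto simp: q_def)
      have qc: "q \<in> carrier (free_module K S)"
        using insert.prems(1) finite_subset[OF qs insert.hyps(1)]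
        by (auto simp: free_module_carrier q_def)
      have "p = q \<oplus>\<^bsub>free_module K S\<^esub> (p i \<odot>\<^bsub>free_module K S\<^esub> basis_elem K i)"
        using pK by (auto simp: q_def basis_elem_def)
      then show ?thesis using sub(4,5) insert.IH[OF qc qs] b[OF True] pK by metis
    qed
  qed
  then show ?thesis using p by (auto simp: free_module_carrier)
qed

context
  fixes K :: "('k, 'm) ring_scheme" and M :: "('k, 'v, 'a) module_scheme" and N
  assumes M: "module K M" and N: "submodule N K M"
begin

interpretation M: module K M by (rule M)

lemma quot_abelian_subgroup: "abelian_subgroup N M"
proof (rule abelian_subgroupI3)
  show "additive_subgroup N M"
    using submodule.axioms(1)[OF N] by (simp add: additive_subgroup_def)
  show "abelian_group M" by (rule M.abelian_group_axioms)
qed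

interpretation N: abelian_subgroup N M by (rule quot_abelian_subgroup)

lemma quot_carrier: "carrier (quot_module M N) = (\<lambda>x. N +>\<^bsub>M\<^esub> x) ` carrier M"
  by (auto simp: quot_module_def A_RCOSETS_def')

lemma quot_zero: "\<zero>\<^bsub>quot_module M N\<^esub> = N +>\<^bsub>M\<^esub> \<zero>\<^bsub>M\<^esub>"
  using M.a_coset_add_zero[OF N.a_subset] by (simp add: quot_module_def)

lemma quot_add:
  "\<lbrakk>x \<in> carrier M; y \<in> carrier M\<rbrakk> \<Longrightarrow>
    (N +>\<^bsub>M\<^esub> x) \<oplus>\<^bsub>quot_module M N\<^esub> (N +>\<^bsub>M\<^esub> y) = N +>\<^bsub>M\<^esub> (x \<oplus>\<^bsub>M\<^esub> y)"
  by (simp add: quot_module_def N.a_rcos_sum)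

lemma quot_eq_iff:
  assumes "x \<in> carrier M" "y \<in> carrier M"
  shows "N +>\<^bsub>M\<^esub> x = N +>\<^bsub>M\<^esub> y \<longleftrightarrow> x \<ominus>\<^bsub>M\<^esub> y \<in> N"
proof
  assume "N +>\<^bsub>M\<^esub> x = N +>\<^bsub>M\<^esub> y"
  then have "x \<in> N +>\<^bsub>M\<^esub> y" using N.a_rcos_self assms by metis
  then show "x \<ominus>\<^bsub>M\<^esub> y \<in> N"
    using N.a_rcos_module_minus[OF _ assms(2,1)] M
    by (metis N.a_rcos_module a_minus_def assms)
next
  assume "x \<ominus>\<^bsub>M\<^esub> y \<in> N"
  then have "x \<in> N +>\<^bsub>M\<^esub> y" using N.a_rcos_module[OF assms(2,1)] by (simp add: a_minus_def)
  then show "N +>\<^bsub>M\<^esub> x = N +>\<^bsub>M\<^esub> y"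
    using N.a_repr_independence' assms(2) by (metis M.a_repr_independence' N.a_subgroup)
qed

lemma quot_smult:
  assumes "c \<in> carrier K" "x \<in> carrier M"
  shows "c \<odot>\<^bsub>quot_module M N\<^esub> (N +>\<^bsub>M\<^esub> x) = N +>\<^bsub>M\<^esub> (c \<odot>\<^bsub>M\<^esub> x)"
proof -
  have eq: "N +>\<^bsub>M\<^esub> (c \<odot>\<^bsub>M\<^esub> y) = N +>\<^bsub>M\<^esub> (c \<odot>\<^bsub>M\<^esub> x)" if y: "y \<in> N +>\<^bsub>M\<^esub> x" for y
  proof -
    have yM: "y \<in> carrier M"
      using y assms N.a_elemrcos_carrier by auto
    have "y \<ominus>\<^bsub>M\<^esub> x \<in> N" using N.a_rcos_module[OF assms(2) yM] y by (simp add: a_minus_def)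
    then have "c \<odot>\<^bsub>M\<^esub> (y \<ominus>\<^bsub>M\<^esub> x) \<in> N" using M.submoduleE(4)[OF N] assms(1) by blast
    then show ?thesis
      using assms yM by (subst quot_eq_iff) (simp_all add: a_minus_def M.smult_r_distr M.smult_r_minus)
  qed
  have "c \<odot>\<^bsub>quot_module M N\<^esub> (N +>\<^bsub>M\<^esub> x) = (\<Union>y\<in>N +>\<^bsub>M\<^esub> x. N +>\<^bsub>M\<^esub> (c \<odot>\<^bsub>M\<^esub> y))"
    by (simp add: quot_module_def)
  also have "\<dots> = (\<Union>y\<in>N +>\<^bsub>M\<^esub> x. N +>\<^bsub>M\<^esub> (c \<odot>\<^bsub>M\<^esub> x))"
    using eq by (rule SUP_cong[OF refl])
  also have "\<dots> = N +>\<^bsub>M\<^esub> (c \<odot>\<^bsub>M\<^esub> x)"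
    using N.a_rcos_self[OF assms(2)] by blast
  finally show ?thesis .
qed

lemma quot_module_module: "module K (quot_module M N)"
proof (rule moduleI)
  show "cring K" by (rule M.R.cring_axioms)
  show "abelian_group (quot_module M N)"
  proof (rule abelian_groupI)
    fix X assume "X \<in> carrier (quot_module M N)"
    then obtain x where x: "x \<in> carrier M" "X = N +>\<^bsub>M\<^esub> x" by (auto simp: quot_carrier)
    then have "N +>\<^bsub>M\<^esub> (\<ominus>\<^bsub>M\<^esub> x) \<in> carrier (quot_module M N)" by (auto simp: quot_carrier)
    moreover have "(N +>\<^bsub>M\<^esub> (\<ominus>\<^bsub>M\<^esub> x)) \<oplus>\<^bsub>quot_module M N\<^esub> X = \<zero>\<^bsub>quot_module M N\<^esub>"
      using x by (simp add: quot_add quot_zero M.M.l_neg)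
    ultimately show "\<exists>Y\<in>carrier (quot_module M N). Y \<oplus>\<^bsub>quot_module M N\<^esub> X = \<zero>\<^bsub>quot_module M N\<^esub>"
      by blast
  next
    fix X Y assume "X \<in> carrier (quot_module M N)" "Y \<in> carrier (quot_module M N)"
    then obtain x y where "x \<in> carrier M" "X = N +>\<^bsub>M\<^esub> x" "y \<in> carrier M" "Y = N +>\<^bsub>M\<^esub> y"
      by (auto simp: quot_carrier)
    then show "X \<oplus>\<^bsub>quot_module M N\<^esub> Y = Y \<oplus>\<^bsub>quot_module M N\<^esub> X"
      by (simp add: quot_add M.M.a_comm)
  qed (auto simp: quot_carrier quot_add quot_zero M.M.a_assoc)
next
  fix c X assume cX: "c \<in> carrier K" "X \<in> carrier (quot_module M N)"
  then obtain x where x: "x \<in> carrier M" "X = N +>\<^bsub>M\<^esub> x" by (auto simp: quot_carrier)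
  show "c \<odot>\<^bsub>quot_module M N\<^esub> X \<in> carrier (quot_module M N)"
    using cX x by (simp add: quot_smult quot_carrier)
  fix d assume d: "d \<in> carrier K"
  show "(c \<oplus>\<^bsub>K\<^esub> d) \<odot>\<^bsub>quot_module M N\<^esub> X =
      c \<odot>\<^bsub>quot_module M N\<^esub> X \<oplus>\<^bsub>quot_module M N\<^esub> d \<odot>\<^bsub>quot_module M N\<^esub> X"
    using cX x d by (simp add: quot_smult quot_add M.smult_l_distr)
  show "(c \<otimes>\<^bsub>K\<^esub> d) \<odot>\<^bsub>quot_module M N\<^esub> X =
      c \<odot>\<^bsub>quot_module M N\<^esub> (d \<odot>\<^bsub>quot_module M N\<^esub> X)"
    using cX x d by (simp add: quot_smult M.smult_assoc1)
next
  fix X assume "X \<in> carrier (quot_module M N)"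
  then show "\<one>\<^bsub>K\<^esub> \<odot>\<^bsub>quot_module M N\<^esub> X = X"
    by (auto simp: quot_carrier quot_smult)
next
  fix c X Y assume "c \<in> carrier K" "X \<in> carrier (quot_module M N)" "Y \<in> carrier (quot_module M N)"
  moreover from this obtain x y
    where "x \<in> carrier M" "X = N +>\<^bsub>M\<^esub> x" "y \<in> carrier M" "Y = N +>\<^bsub>M\<^esub> y"
    by (auto simp: quot_carrier)
  ultimately show "c \<odot>\<^bsub>quot_module M N\<^esub> (X \<oplus>\<^bsub>quot_module M N\<^esub> Y) =
      c \<odot>\<^bsub>quot_module M N\<^esub> X \<oplus>\<^bsub>quot_module M N\<^esub> c \<odot>\<^bsub>quot_module M N\<^esub> Y"
    by (simp add: quot_smult quot_add M.smult_r_distr)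
qed

lemma quot_proj_linear: "(\<lambda>x. N +>\<^bsub>M\<^esub> x) \<in> lin_maps K M (quot_module M N)"
  by (rule lin_mapsI) (simp_all add: quot_carrier quot_add quot_smult)

lemma quot_lift:
  assumes U: "module K U" and F: "F \<in> lin_maps K M U" and ker: "\<And>x. x \<in> N \<Longrightarrow> F x = \<zero>\<^bsub>U\<^esub>"
  obtains h where "h \<in> lin_maps K (quot_module M N) U" "\<And>x. x \<in> carrier M \<Longrightarrow> h (N +>\<^bsub>M\<^esub> x) = F x"
proof -
  interpret U: module K U by (rule U)
  define h where "h X = F (SOME x. x \<in> carrier M \<and> X = N +>\<^bsub>M\<^esub> x)" for X
  have h: "h (N +>\<^bsub>M\<^esub> x) = F x" if x: "x \<in> carrier M" for x
  proof -
    define y where "y = (SOME y. y \<in> carrier M \<and> N +>\<^bsub>M\<^esub> x = N +>\<^bsub>M\<^esub> y)"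
    have y: "y \<in> carrier M \<and> N +>\<^bsub>M\<^esub> x = N +>\<^bsub>M\<^esub> y"
      unfolding y_def by (rule someI[of _ x]) (simp add: x)
    then have "F (x \<ominus>\<^bsub>M\<^esub> y) = \<zero>\<^bsub>U\<^esub>" using quot_eq_iff x ker by blast
    then have "F x \<ominus>\<^bsub>U\<^esub> F y = \<zero>\<^bsub>U\<^esub>" using lin_map_minus[OF M U F] x y by simp
    moreover have "F x = (F x \<ominus>\<^bsub>U\<^esub> F y) \<oplus>\<^bsub>U\<^esub> F y"
      using lin_mapsD(1)[OF F] x y by (simp add: a_minus_def U.M.a_assoc U.M.l_neg)
    ultimately have "F x = F y" using lin_mapsD(1)[OF F] y by simp
    then show ?thesis by (simp add: h_def y_def)
  qed
  have "h \<in> lin_maps K (quot_module M N) U"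
  proof (rule lin_mapsI)
    fix X assume "X \<in> carrier (quot_module M N)"
    then obtain x where x: "x \<in> carrier M" "X = N +>\<^bsub>M\<^esub> x" by (auto simp: quot_carrier)
    then show "h X \<in> carrier U" by (simp add: h lin_mapsD(1)[OF F])
    show "h (c \<odot>\<^bsub>quot_module M N\<^esub> X) = c \<odot>\<^bsub>U\<^esub> h X" if "c \<in> carrier K" for c
      using x that by (simp add: quot_smult h lin_mapsD(3)[OF F])
    fix Y assume "Y \<in> carrier (quot_module M N)"
    then obtain y where y: "y \<in> carrier M" "Y = N +>\<^bsub>M\<^esub> y" by (auto simp: quot_carrier)
    show "h (X \<oplus>\<^bsub>quot_module M N\<^esub> Y) = h X \<oplus>\<^bsub>U\<^esub> h Y"
      using x y by (simp add: quot_add h lin_mapsD(2)[OF F])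
  qed
  then show ?thesis using h that by blast
qed

end


lemma free_module_lift:
  assumes K: "cring K" and U: "module K U" and g: "g \<in> S \<rightarrow> carrier U"
  obtains F where "F \<in> lin_maps K (free_module K S) U" "\<And>s. s \<in> S \<Longrightarrow> F (basis_elem K s) = g s"
proof -
  interpret U: module K U by (rule U)
  define F where "F p = (\<Oplus>\<^bsub>U\<^esub>x\<in>{x. p x \<noteq> \<zero>\<^bsub>K\<^esub>}. p x \<odot>\<^bsub>U\<^esub> g x)" for p
  have F: "F p = (\<Oplus>\<^bsub>U\<^esub>x\<in>I. p x \<odot>\<^bsub>U\<^esub> g x)"
    if "p \<in> carrier (free_module K S)" "{x. p x \<noteq> \<zero>\<^bsub>K\<^esub>} \<subseteq> I" "finite I" "I \<subseteq> S" for p I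
    unfolding F_def
    by (rule U.M.add.finprod_mono_neutral_cong_left)
      (use that g in \<open>auto simp: free_module_carrier Pi_iff subset_iff\<close>)
  have supp: "{x. p x \<noteq> \<zero>\<^bsub>K\<^esub>} \<subseteq> S" "finite {x. p x \<noteq> \<zero>\<^bsub>K\<^esub>}" "\<And>x. p x \<in> carrier K"
    if "p \<in> carrier (free_module K S)" for p
    using that by (auto simp: free_module_carrier)
  interpret F: module K "free_module K S" by (rule free_module_module[OF K])
  have "F \<in> lin_maps K (free_module K S) U"
  proof (rule lin_mapsI)
    fix p assume p: "p \<in> carrier (free_module K S)"
    show "F p \<in> carrier U"
      unfolding F_def by (rule U.M.finsum_closed) (use supp[OF p] g in auto)
    fix q assume q: "q \<in> carrier (free_module K S)"
    define I where "I = {x. p x \<noteq> \<zero>\<^bsub>K\<^esub>} \<union> {x. q x \<noteq> \<zero>\<^bsub>K\<^esub>}"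
    have I: "finite I" "I \<subseteq> S" using supp[OF p] supp[OF q] by (auto simp: I_def)
    have pI: "F p = (\<Oplus>\<^bsub>U\<^esub>x\<in>I. p x \<odot>\<^bsub>U\<^esub> g x)" by (rule F[OF p _ I]) (auto simp: I_def)
    have qI: "F q = (\<Oplus>\<^bsub>U\<^esub>x\<in>I. q x \<odot>\<^bsub>U\<^esub> g x)" by (rule F[OF q _ I]) (auto simp: I_def)
    have sub: "{x. (p \<oplus>\<^bsub>free_module K S\<^esub> q) x \<noteq> \<zero>\<^bsub>K\<^esub>} \<subseteq> I" by (auto simp: I_def)
    have "F (p \<oplus>\<^bsub>free_module K S\<^esub> q) = (\<Oplus>\<^bsub>U\<^esub>x\<in>I. (p x \<oplus>\<^bsub>K\<^esub> q x) \<odot>\<^bsub>U\<^esub> g x)"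
      using F[OF F.M.a_closed[OF p q] sub I] by simp
    also have "\<dots> = (\<Oplus>\<^bsub>U\<^esub>x\<in>I. p x \<odot>\<^bsub>U\<^esub> g x \<oplus>\<^bsub>U\<^esub> q x \<odot>\<^bsub>U\<^esub> g x)"
      by (rule U.M.finsum_cong')
        (use supp[OF p] supp[OF q] I g in \<open>auto simp: U.smult_l_distr Pi_iff subset_iff\<close>)
    also have "\<dots> = F p \<oplus>\<^bsub>U\<^esub> F q"
      unfolding pI qI
      by (rule U.M.finsum_addf) (use supp[OF p] supp[OF q] I g in \<open>auto simp: Pi_iff subset_iff\<close>)
    finally show "F (p \<oplus>\<^bsub>free_module K S\<^esub> q) = F p \<oplus>\<^bsub>U\<^esub> F q" .
  next
    fix c p assume c: "c \<in> carrier K" and p: "p \<in> carrier (free_module K S)"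
    define I where "I = {x. p x \<noteq> \<zero>\<^bsub>K\<^esub>}"
    have I: "finite I" "I \<subseteq> S" using supp[OF p] by (auto simp: I_def)
    have sub: "{x. (c \<odot>\<^bsub>free_module K S\<^esub> p) x \<noteq> \<zero>\<^bsub>K\<^esub>} \<subseteq> I" using c by (auto simp: I_def)
    have "F (c \<odot>\<^bsub>free_module K S\<^esub> p) = (\<Oplus>\<^bsub>U\<^esub>x\<in>I. (c \<otimes>\<^bsub>K\<^esub> p x) \<odot>\<^bsub>U\<^esub> g x)"
      using F[OF F.smult_closed[OF c p] sub I] by simp
    also have "\<dots> = (\<Oplus>\<^bsub>U\<^esub>x\<in>I. c \<odot>\<^bsub>U\<^esub> (p x \<odot>\<^bsub>U\<^esub> g x))"
      by (rule U.M.finsum_cong')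
        (use supp[OF p] c I g in \<open>auto simp: U.smult_assoc1 Pi_iff subset_iff\<close>)
    also have "\<dots> = c \<odot>\<^bsub>U\<^esub> F p"
      unfolding F_def I_def[symmetric]
      by (rule U.finsum_smult_ldistr[symmetric])
        (use supp[OF p] c I g in \<open>auto simp: Pi_iff subset_iff\<close>)
    finally show "F (c \<odot>\<^bsub>free_module K S\<^esub> p) = c \<odot>\<^bsub>U\<^esub> F p" .
  qed
  moreover have "F (basis_elem K s) = g s" if s: "s \<in> S" for s
  proof -
    have "F (basis_elem K s) = (\<Oplus>\<^bsub>U\<^esub>x\<in>{s}. basis_elem K s x \<odot>\<^bsub>U\<^esub> g x)"
      by (rule F[OF basis_elem_closed[OF K s]]) (use s in \<open>auto simp: basis_elem_def\<close>)
    also have "\<dots> = g s"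
      using s g by (simp add: basis_elem_def Pi_iff)
    finally show ?thesis .
  qed
  ultimately show ?thesis using that by blast
qed

lemma bilinearD:
  assumes "bilinear K V W U f"
  shows "\<lbrakk>v \<in> carrier V; w \<in> carrier W\<rbrakk> \<Longrightarrow> f v w \<in> carrier U"
    and "\<lbrakk>v \<in> carrier V; v' \<in> carrier V; w \<in> carrier W\<rbrakk> \<Longrightarrow> f (v \<oplus>\<^bsub>V\<^esub> v') w = f v w \<oplus>\<^bsub>U\<^esub> f v' w"
    and "\<lbrakk>v \<in> carrier V; w \<in> carrier W; w' \<in> carrier W\<rbrakk> \<Longrightarrow> f v (w \<oplus>\<^bsub>W\<^esub> w') = f v w \<oplus>\<^bsub>U\<^esub> f v w'"
    and "\<lbrakk>c \<in> carrier K; v \<in> carrier V; w \<in> carrier W\<rbrakk> \<Longrightarrow> f (c \<odot>\<^bsub>V\<^esub> v) w = c \<odot>\<^bsub>U\<^esub> f v w"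
    and "\<lbrakk>c \<in> carrier K; v \<in> carrier V; w \<in> carrier W\<rbrakk> \<Longrightarrow> f v (c \<odot>\<^bsub>W\<^esub> w) = c \<odot>\<^bsub>U\<^esub> f v w"
  using assms unfolding bilinear_def lin_maps_def by auto

lemma bilinearI:
  assumes "\<And>v w. \<lbrakk>v \<in> carrier V; w \<in> carrier W\<rbrakk> \<Longrightarrow> f v w \<in> carrier U"
    and "\<And>v v' w. \<lbrakk>v \<in> carrier V; v' \<in> carrier V; w \<in> carrier W\<rbrakk> \<Longrightarrow> f (v \<oplus>\<^bsub>V\<^esub> v') w = f v w \<oplus>\<^bsub>U\<^esub> f v' w"
    and "\<And>v w w'. \<lbrakk>v \<in> carrier V; w \<in> carrier W; w' \<in> carrier W\<rbrakk> \<Longrightarrow> f v (w \<oplus>\<^bsub>W\<^esub> w') = f v w \<oplus>\<^bsub>U\<^esub> f v w'"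
    and "\<And>c v w. \<lbrakk>c \<in> carrier K; v \<in> carrier V; w \<in> carrier W\<rbrakk> \<Longrightarrow> f (c \<odot>\<^bsub>V\<^esub> v) w = c \<odot>\<^bsub>U\<^esub> f v w"
    and "\<And>c v w. \<lbrakk>c \<in> carrier K; v \<in> carrier V; w \<in> carrier W\<rbrakk> \<Longrightarrow> f v (c \<odot>\<^bsub>W\<^esub> w) = c \<odot>\<^bsub>U\<^esub> f v w"
  shows "bilinear K V W U f"
  using assms unfolding bilinear_def lin_maps_def by auto

context
  fixes K :: "('k, 'm) ring_scheme" and V :: "('k, 'v, 'a) module_scheme"
    and W :: "('k, 'w, 'b) module_scheme"
  assumes V: "module K V" and W: "module K W"
begin

interpretation V: module K V by (rule V)
interpretation W: module K W by (rule W)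

abbreviation (input) "FV \<equiv> free_module K (carrier V \<times> carrier W)"

interpretation F: module K FV
  by (rule free_module_module[OF V.R.cring_axioms])

lemma tensor_basis_closed:
  "\<lbrakk>v \<in> carrier V; w \<in> carrier W\<rbrakk> \<Longrightarrow> basis_elem K (v, w) \<in> carrier FV"
  by (rule basis_elem_closed[OF V.R.cring_axioms]) simp

lemma tensor_relations_closed: "tensor_relations K V W \<subseteq> carrier FV"
proof -
  have sm: "\<lbrakk>c \<in> carrier K; p \<in> carrier FV\<rbrakk> \<Longrightarrow> (\<lambda>x. c \<otimes>\<^bsub>K\<^esub> p x) \<in> carrier FV"
    and ad: "\<lbrakk>p \<in> carrier FV; q \<in> carrier FV\<rbrakk> \<Longrightarrow> (\<lambda>x. p x \<oplus>\<^bsub>K\<^esub> q x) \<in> carrier FV" for c p q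
    using F.smult_closed[of c p] F.M.a_closed[of p q] by simp_all
  show ?thesis
    unfolding tensor_relations_def Let_def
    by (auto intro!: F.M.minus_closed tensor_basis_closed sm ad)
qed

lemma tensor_null_submodule: "submodule (tensor_null K V W) K FV"
proof (rule F.submoduleI)
  let ?S = "{N. submodule N K FV \<and> tensor_relations K V W \<subseteq> N}"
  have "carrier FV \<in> ?S" using F.carrier_is_submodule tensor_relations_closed by simp
  then show "tensor_null K V W \<subseteq> carrier FV" unfolding tensor_null_def by blast
  show "\<zero>\<^bsub>FV\<^esub> \<in> tensor_null K V W"
    unfolding tensor_null_def
    using subgroup.one_closed[OF submodule.axioms(1)] by fastforce
  show "\<And>a. a \<in> tensor_null K V W \<Longrightarrow> \<ominus>\<^bsub>FV\<^esub> a \<in> tensor_null K V W"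
    unfolding tensor_null_def using F.submoduleE(3) by blast
  show "\<And>a b. \<lbrakk>a \<in> tensor_null K V W; b \<in> tensor_null K V W\<rbrakk> \<Longrightarrow> a \<oplus>\<^bsub>FV\<^esub> b \<in> tensor_null K V W"
    unfolding tensor_null_def using F.submoduleE(5) by blast
  show "\<And>a x. \<lbrakk>a \<in> carrier K; x \<in> tensor_null K V W\<rbrakk> \<Longrightarrow> a \<odot>\<^bsub>FV\<^esub> x \<in> tensor_null K V W"
    unfolding tensor_null_def using F.submoduleE(4) by blast
qed

lemma tensor_relations_null: "tensor_relations K V W \<subseteq> tensor_null K V W"
  unfolding tensor_null_def by blast

lemma tensor_module: "module K (tensor K V W)"
  unfolding tensor_def by (rule quot_module_module[OF F.module_axioms tensor_null_submodule])

lemma pure_tensor_bilinear: "bilinear K V W (tensor K V W) (pure_tensor K V W)"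
proof -
  note sub = F.module_axioms tensor_null_submodule
  note b = tensor_basis_closed
  let ?e = "\<lambda>v w. basis_elem K (v, w)"
  let ?N = "tensor_null K V W"
  have rel: "?N +>\<^bsub>FV\<^esub> p = ?N +>\<^bsub>FV\<^esub> q"
    if "p \<in> carrier FV" "q \<in> carrier FV" "p \<ominus>\<^bsub>FV\<^esub> q \<in> tensor_relations K V W" for p q
    using that tensor_relations_null quot_eq_iff[OF sub] by blast
  show ?thesis
  proof (rule bilinearI, unfold pure_tensor_def tensor_def)
    fix v w assume "v \<in> carrier V" "w \<in> carrier W"
    then show "?N +>\<^bsub>FV\<^esub> ?e v w \<in> carrier (quot_module FV ?N)"
      using b quot_carrier[OF sub] by blast
  next
    fix v v' w assume *: "v \<in> carrier V" "v' \<in> carrier V" "w \<in> carrier W"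
    have "?N +>\<^bsub>FV\<^esub> ?e (v \<oplus>\<^bsub>V\<^esub> v') w = ?N +>\<^bsub>FV\<^esub> (?e v w \<oplus>\<^bsub>FV\<^esub> ?e v' w)"
    proof (rule rel)
      show "?e v w \<oplus>\<^bsub>FV\<^esub> ?e v' w \<in> carrier FV" by (rule F.M.a_closed) (use * b in auto)
      show "?e (v \<oplus>\<^bsub>V\<^esub> v') w \<ominus>\<^bsub>FV\<^esub> (?e v w \<oplus>\<^bsub>FV\<^esub> ?e v' w) \<in> tensor_relations K V W"
        unfolding tensor_relations_def Let_def using * by blast
    qed (use * b in auto)
    then show "?N +>\<^bsub>FV\<^esub> ?e (v \<oplus>\<^bsub>V\<^esub> v') w =
        (?N +>\<^bsub>FV\<^esub> ?e v w) \<oplus>\<^bsub>quot_module FV ?N\<^esub> (?N +>\<^bsub>FV\<^esub> ?e v' w)"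
      using quot_add[OF sub b b] * by metis
  next
    fix v w w' assume *: "v \<in> carrier V" "w \<in> carrier W" "w' \<in> carrier W"
    have "?N +>\<^bsub>FV\<^esub> ?e v (w \<oplus>\<^bsub>W\<^esub> w') = ?N +>\<^bsub>FV\<^esub> (?e v w \<oplus>\<^bsub>FV\<^esub> ?e v w')"
    proof (rule rel)
      show "?e v w \<oplus>\<^bsub>FV\<^esub> ?e v w' \<in> carrier FV" by (rule F.M.a_closed) (use * b in auto)
      show "?e v (w \<oplus>\<^bsub>W\<^esub> w') \<ominus>\<^bsub>FV\<^esub> (?e v w \<oplus>\<^bsub>FV\<^esub> ?e v w') \<in> tensor_relations K V W"
        unfolding tensor_relations_def Let_def using * by blast
    qed (use * b in auto)
    then show "?N +>\<^bsub>FV\<^esub> ?e v (w \<oplus>\<^bsub>W\<^esub> w') =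
        (?N +>\<^bsub>FV\<^esub> ?e v w) \<oplus>\<^bsub>quot_module FV ?N\<^esub> (?N +>\<^bsub>FV\<^esub> ?e v w')"
      using quot_add[OF sub b b] * by metis
  next
    fix c v w assume *: "c \<in> carrier K" "v \<in> carrier V" "w \<in> carrier W"
    have "?N +>\<^bsub>FV\<^esub> ?e (c \<odot>\<^bsub>V\<^esub> v) w = ?N +>\<^bsub>FV\<^esub> (c \<odot>\<^bsub>FV\<^esub> ?e v w)"
    proof (rule rel)
      show "c \<odot>\<^bsub>FV\<^esub> ?e v w \<in> carrier FV" by (rule F.smult_closed) (use * b in auto)
      show "?e (c \<odot>\<^bsub>V\<^esub> v) w \<ominus>\<^bsub>FV\<^esub> (c \<odot>\<^bsub>FV\<^esub> ?e v w) \<in> tensor_relations K V W"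
        unfolding tensor_relations_def Let_def using * by blast
    qed (use * b in auto)
    then show "?N +>\<^bsub>FV\<^esub> ?e (c \<odot>\<^bsub>V\<^esub> v) w = c \<odot>\<^bsub>quot_module FV ?N\<^esub> (?N +>\<^bsub>FV\<^esub> ?e v w)"
      using quot_smult[OF sub _ b] * by metis
  next
    fix c v w assume *: "c \<in> carrier K" "v \<in> carrier V" "w \<in> carrier W"
    have "?N +>\<^bsub>FV\<^esub> ?e v (c \<odot>\<^bsub>W\<^esub> w) = ?N +>\<^bsub>FV\<^esub> (c \<odot>\<^bsub>FV\<^esub> ?e v w)"
    proof (rule rel)
      show "c \<odot>\<^bsub>FV\<^esub> ?e v w \<in> carrier FV" by (rule F.smult_closed) (use * b in auto)
      show "?e v (c \<odot>\<^bsub>W\<^esub> w) \<ominus>\<^bsub>FV\<^esub> (c \<odot>\<^bsub>FV\<^esub> ?e v w) \<in> tensor_relations K V W"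
        unfolding tensor_relations_def Let_def using * by blast
    qed (use * b in auto)
    then show "?N +>\<^bsub>FV\<^esub> ?e v (c \<odot>\<^bsub>W\<^esub> w) = c \<odot>\<^bsub>quot_module FV ?N\<^esub> (?N +>\<^bsub>FV\<^esub> ?e v w)"
      using quot_smult[OF sub _ b] * by metis
  qed
qed

lemma tensor_hom_ext:
  assumes U: "module K U"
    and g: "g \<in> lin_maps K (tensor K V W) U" and h: "h \<in> lin_maps K (tensor K V W) U"
    and eq: "\<And>v w. \<lbrakk>v \<in> carrier V; w \<in> carrier W\<rbrakk> \<Longrightarrow> g (pure_tensor K V W v w) = h (pure_tensor K V W v w)"
    and t: "t \<in> carrier (tensor K V W)"
  shows "g t = h t"
proof -
  let ?N = "tensor_null K V W"
  note sub = F.module_axioms tensor_null_submodule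
  have lin: "(\<lambda>p. k (?N +>\<^bsub>FV\<^esub> p)) \<in> lin_maps K FV U" if "k \<in> lin_maps K (tensor K V W) U" for k
    using quot_proj_linear[OF sub] that unfolding tensor_def lin_maps_def by (auto simp: Pi_iff)
  note S = lin_maps_eq_submodule[OF F.module_axioms U lin[OF g] lin[OF h]]
  obtain p where p: "p \<in> carrier FV" "t = ?N +>\<^bsub>FV\<^esub> p"
    using t quot_carrier[OF sub] unfolding tensor_def by blast
  have "p \<in> {p \<in> carrier FV. g (?N +>\<^bsub>FV\<^esub> p) = h (?N +>\<^bsub>FV\<^esub> p)}"
    by (rule free_module_span[OF V.R.cring_axioms S _ p(1)])
      (use eq tensor_basis_closed in \<open>auto simp: pure_tensor_def\<close>)
  then show ?thesis using p by simp
qed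

lemma tensor_universal:
  assumes U: "module K U" and f: "bilinear K V W U f"
  shows "\<exists>!h. h \<in> lin_maps K (tensor K V W) U \<and> h \<in> extensional (carrier (tensor K V W)) \<and>
              (\<forall>v\<in>carrier V. \<forall>w\<in>carrier W. h (pure_tensor K V W v w) = f v w)"
proof (rule ex_ex1I)
  interpret U: module K U by (rule U)
  note sub = F.module_axioms tensor_null_submodule
  have g: "case_prod f \<in> carrier V \<times> carrier W \<rightarrow> carrier U" using bilinearD(1)[OF f] by auto
  obtain F where F: "F \<in> lin_maps K FV U"
    and Fb: "\<And>v w. \<lbrakk>v \<in> carrier V; w \<in> carrier W\<rbrakk> \<Longrightarrow> F (basis_elem K (v, w)) = f v w"
    by (rule free_module_lift[OF V.R.cring_axioms U g]) auto
  have Z: "(\<lambda>x. \<zero>\<^bsub>U\<^esub>) \<in> lin_maps K FV U" by (rule lin_mapsI) auto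
  let ?ker = "{p \<in> carrier FV. F p = \<zero>\<^bsub>U\<^esub>}"
  have "submodule ?ker K FV" by (rule lin_maps_eq_submodule[OF F.module_axioms U F Z])
  moreover have "tensor_relations K V W \<subseteq> ?ker"
  proof
    have diff: "F (p \<ominus>\<^bsub>FV\<^esub> q) = \<zero>\<^bsub>U\<^esub>" if "p \<in> carrier FV" "q \<in> carrier FV" "F p = F q" for p q
      using that lin_map_minus[OF F.module_axioms U F that(1,2)] lin_mapsD(1)[OF F]
      by (simp add: a_minus_def U.M.r_neg)
    note b = tensor_basis_closed
    fix r assume r: "r \<in> tensor_relations K V W"
    then have "F r = \<zero>\<^bsub>U\<^esub>"
      unfolding tensor_relations_def Let_def
      apply (elim UnE CollectE exE conjE)
         apply (simp only:, rule diff;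
           (intro b F.M.a_closed F.smult_closed V.M.a_closed W.M.a_closed V.smult_closed W.smult_closed)?;
           (simp only: lin_mapsD[OF F] Fb bilinearD[OF f] b
             V.M.a_closed W.M.a_closed V.smult_closed W.smult_closed)?)+
      done
    then show "r \<in> ?ker" using r tensor_relations_closed by blast
  qed
  ultimately have "tensor_null K V W \<subseteq> ?ker" unfolding tensor_null_def by blast
  then obtain h where h: "h \<in> lin_maps K (tensor K V W) U"
    "\<And>p. p \<in> carrier FV \<Longrightarrow> h (tensor_null K V W +>\<^bsub>FV\<^esub> p) = F p"
    unfolding tensor_def using quot_lift[OF sub U F] by blast
  interpret T: module K "tensor K V W" by (rule tensor_module)
  let ?h = "restrict h (carrier (tensor K V W))"
  have "?h \<in> lin_maps K (tensor K V W) U"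
    by (rule lin_mapsI) (auto simp: lin_mapsD[OF h(1)])
  moreover have "?h (pure_tensor K V W v w) = f v w" if "v \<in> carrier V" "w \<in> carrier W" for v w
    using bilinearD(1)[OF pure_tensor_bilinear] h(2) Fb tensor_basis_closed that
    by (simp add: pure_tensor_def)
  ultimately show "\<exists>h. h \<in> lin_maps K (tensor K V W) U \<and> h \<in> extensional (carrier (tensor K V W)) \<and>
      (\<forall>v\<in>carrier V. \<forall>w\<in>carrier W. h (pure_tensor K V W v w) = f v w)"
    by blast
next
  fix g h
  assume *: "g \<in> lin_maps K (tensor K V W) U \<and> g \<in> extensional (carrier (tensor K V W)) \<and>
      (\<forall>v\<in>carrier V. \<forall>w\<in>carrier W. g (pure_tensor K V W v w) = f v w)"
    "h \<in> lin_maps K (tensor K V W) U \<and> h \<in> extensional (carrier (tensor K V W)) \<and>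
      (\<forall>v\<in>carrier V. \<forall>w\<in>carrier W. h (pure_tensor K V W v w) = f v w)"
  show "g = h"
    by (rule extensionalityI[of g "carrier (tensor K V W)"]) (use * tensor_hom_ext[OF U] in auto)
qed

lemma tensor_lift:
  assumes "module K U" and "bilinear K V W U f"
  shows tensor_lift_linear: "tensor_lift K V W U f \<in> lin_maps K (tensor K V W) U"
    and tensor_lift_pure: "\<lbrakk>v \<in> carrier V; w \<in> carrier W\<rbrakk> \<Longrightarrow>
      tensor_lift K V W U f (pure_tensor K V W v w) = f v w"
  using theI'[OF tensor_universal[OF assms]] unfolding tensor_lift_def by blast+

end


lemma tensor_map_bilinear:
  assumes mods: "module K V'" "module K W'"
    and f: "f \<in> lin_maps K V V'" and g: "g \<in> lin_maps K W W'"
  shows "bilinear K V W (tensor K V' W') (\<lambda>v w. pure_tensor K V' W' (f v) (g w))"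
  by (rule bilinearI)
    (simp_all add: bilinearD[OF pure_tensor_bilinear[OF mods]] lin_mapsD[OF f] lin_mapsD[OF g])

lemma tensor_map:
  assumes mods: "module K V" "module K W" "module K V'" "module K W'"
    and f: "f \<in> lin_maps K V V'" and g: "g \<in> lin_maps K W W'"
  shows tensor_map_linear: "tensor_map K V W V' W' f g \<in> lin_maps K (tensor K V W) (tensor K V' W')"
    and tensor_map_pure: "\<lbrakk>v \<in> carrier V; w \<in> carrier W\<rbrakk> \<Longrightarrow>
      tensor_map K V W V' W' f g (pure_tensor K V W v w) = pure_tensor K V' W' (f v) (g w)"
  unfolding tensor_map_def
  using tensor_lift[OF mods(1,2) tensor_module[OF mods(3,4)] tensor_map_bilinear[OF mods(3,4) f g]]
  by blast+

lemma lin_maps_add: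
  assumes "module K M" "module K P" "f \<in> lin_maps K M P" "g \<in> lin_maps K M P"
  shows "(\<lambda>x. f x \<oplus>\<^bsub>P\<^esub> g x) \<in> lin_maps K M P"
proof -
  interpret P: module K P by fact
  note f = lin_mapsD[OF assms(3)] and g = lin_mapsD[OF assms(4)]
  show ?thesis
    by (rule lin_mapsI) (simp_all add: f g P.smult_r_distr P.M.a_ac)
qed

lemma lin_maps_smult:
  assumes "module K M" "module K P" "f \<in> lin_maps K M P" "c \<in> carrier K"
  shows "(\<lambda>x. c \<odot>\<^bsub>P\<^esub> f x) \<in> lin_maps K M P"
proof -
  interpret P: module K P by fact
  note f = lin_mapsD[OF assms(3)]
  show ?thesis
    by (rule lin_mapsI)
      (simp_all add: f assms(4) P.smult_r_distr P.smult_assoc1[symmetric] P.R.m_comm)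
qed

lemma tensor_lift_family_bilinear:
  assumes M: "module K M" and P: "module K P" and Q: "module K Q" and R: "module K R"
    and g: "\<And>r. r \<in> carrier R \<Longrightarrow> bilinear K P Q M (\<lambda>p q. g p q r)"
    and g': "\<And>p q. \<lbrakk>p \<in> carrier P; q \<in> carrier Q\<rbrakk> \<Longrightarrow> g p q \<in> lin_maps K R M"
  shows "bilinear K (tensor K P Q) R M (\<lambda>t r. tensor_lift K P Q M (\<lambda>p q. g p q r) t)"
    and "bilinear K R (tensor K P Q) M (\<lambda>r. tensor_lift K P Q M (\<lambda>p q. g p q r))"
proof -
  interpret R: module K R by (rule R)
  interpret T: module K "tensor K P Q" by (rule tensor_module[OF P Q])
  let ?l = "\<lambda>r. tensor_lift K P Q M (\<lambda>p q. g p q r)"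
  note lin = tensor_lift_linear[OF P Q M g] and pure = tensor_lift_pure[OF P Q M g]
  have add: "?l (r \<oplus>\<^bsub>R\<^esub> r') t = ?l r t \<oplus>\<^bsub>M\<^esub> ?l r' t"
    if "r \<in> carrier R" "r' \<in> carrier R" "t \<in> carrier (tensor K P Q)" for r r' t
    by (rule tensor_hom_ext[OF P Q M lin lin_maps_add[OF T.module_axioms M lin lin]])
      (use that in \<open>simp_all add: pure lin_mapsD[OF g']\<close>)
  have smult: "?l (c \<odot>\<^bsub>R\<^esub> r) t = c \<odot>\<^bsub>M\<^esub> ?l r t"
    if "c \<in> carrier K" "r \<in> carrier R" "t \<in> carrier (tensor K P Q)" for c r t
    by (rule tensor_hom_ext[OF P Q M lin lin_maps_smult[OF T.module_axioms M lin]])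
      (use that in \<open>simp_all add: pure lin_mapsD[OF g']\<close>)
  show "bilinear K (tensor K P Q) R M (\<lambda>t r. ?l r t)" "bilinear K R (tensor K P Q) M ?l"
    by (rule bilinearI; simp add: add smult lin_mapsD[OF lin])+
qed

context
  fixes K :: "('k, 'm) ring_scheme" and U :: "('k, 'u, 'a) module_scheme"
    and V :: "('k, 'v, 'b) module_scheme" and W :: "('k, 'w, 'c) module_scheme"
  assumes U: "module K U" and V: "module K V" and W: "module K W"
begin

lemma tensor_assoc:
  shows tensor_assoc_linear: "tensor_assoc K U V W \<in>
      lin_maps K (tensor K (tensor K U V) W) (tensor K U (tensor K V W))"
    and tensor_assoc_pure: "\<lbrakk>u \<in> carrier U; v \<in> carrier V; w \<in> carrier W\<rbrakk> \<Longrightarrow>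
      tensor_assoc K U V W (pure_tensor K (tensor K U V) W (pure_tensor K U V u v) w) =
      pure_tensor K U (tensor K V W) u (pure_tensor K V W v w)"
proof -
  let ?VW = "tensor K V W"
  let ?T = "tensor K U ?VW"
  let ?g = "\<lambda>u v w. pure_tensor K U ?VW u (pure_tensor K V W v w)"
  note VW = tensor_module[OF V W]
  note T = tensor_module[OF U VW]
  note b = bilinearD[OF pure_tensor_bilinear[OF U VW]] bilinearD[OF pure_tensor_bilinear[OF V W]]
  have g: "bilinear K U V ?T (\<lambda>u v. ?g u v w)" if "w \<in> carrier W" for w
    by (rule bilinearI) (use that in \<open>simp_all add: b\<close>)
  have g': "?g u v \<in> lin_maps K W ?T" if "u \<in> carrier U" "v \<in> carrier V" for u v
    by (rule lin_mapsI) (use that in \<open>simp_all add: b\<close>)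
  note fam = tensor_lift_family_bilinear(1)[OF T U V W g g']
  show "tensor_assoc K U V W \<in> lin_maps K (tensor K (tensor K U V) W) ?T"
    unfolding tensor_assoc_def Let_def by (rule tensor_lift_linear[OF tensor_module[OF U V] W T fam])
  show "tensor_assoc K U V W (pure_tensor K (tensor K U V) W (pure_tensor K U V u v) w) = ?g u v w"
    if "u \<in> carrier U" "v \<in> carrier V" "w \<in> carrier W"
    unfolding tensor_assoc_def Let_def
    using that bilinearD(1)[OF pure_tensor_bilinear[OF U V]]
    by (simp add: tensor_lift_pure[OF tensor_module[OF U V] W T fam] tensor_lift_pure[OF U V T g])
qed

lemma tensor_assoc_inv:
  shows tensor_assoc_inv_linear: "tensor_assoc_inv K U V W \<in>
      lin_maps K (tensor K U (tensor K V W)) (tensor K (tensor K U V) W)"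
    and tensor_assoc_inv_pure: "\<lbrakk>u \<in> carrier U; v \<in> carrier V; w \<in> carrier W\<rbrakk> \<Longrightarrow>
      tensor_assoc_inv K U V W (pure_tensor K U (tensor K V W) u (pure_tensor K V W v w)) =
      pure_tensor K (tensor K U V) W (pure_tensor K U V u v) w"
proof -
  let ?UV = "tensor K U V"
  let ?T = "tensor K ?UV W"
  let ?g = "\<lambda>v w u. pure_tensor K ?UV W (pure_tensor K U V u v) w"
  note UV = tensor_module[OF U V]
  note T = tensor_module[OF UV W]
  note b = bilinearD[OF pure_tensor_bilinear[OF UV W]] bilinearD[OF pure_tensor_bilinear[OF U V]]
  have g: "bilinear K V W ?T (\<lambda>v w. ?g v w u)" if "u \<in> carrier U" for u
    by (rule bilinearI) (use that in \<open>simp_all add: b\<close>)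
  have g': "?g v w \<in> lin_maps K U ?T" if "v \<in> carrier V" "w \<in> carrier W" for v w
    by (rule lin_mapsI) (use that in \<open>simp_all add: b\<close>)
  note fam = tensor_lift_family_bilinear(2)[OF T V W U g g']
  show "tensor_assoc_inv K U V W \<in> lin_maps K (tensor K U (tensor K V W)) ?T"
    unfolding tensor_assoc_inv_def Let_def by (rule tensor_lift_linear[OF U tensor_module[OF V W] T fam])
  show "tensor_assoc_inv K U V W (pure_tensor K U (tensor K V W) u (pure_tensor K V W v w)) = ?g v w u"
    if "u \<in> carrier U" "v \<in> carrier V" "w \<in> carrier W"
    unfolding tensor_assoc_inv_def Let_def
    using that bilinearD(1)[OF pure_tensor_bilinear[OF V W]]
    by (simp add: tensor_lift_pure[OF U tensor_module[OF V W] T fam] tensor_lift_pure[OF V W T g])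
qed

lemma tensor_hom_ext3:
  assumes P: "module K P"
    and g: "g \<in> lin_maps K (tensor K (tensor K U V) W) P"
    and h: "h \<in> lin_maps K (tensor K (tensor K U V) W) P"
    and eq: "\<And>u v w. \<lbrakk>u \<in> carrier U; v \<in> carrier V; w \<in> carrier W\<rbrakk> \<Longrightarrow>
      g (pure_tensor K (tensor K U V) W (pure_tensor K U V u v) w) =
      h (pure_tensor K (tensor K U V) W (pure_tensor K U V u v) w)"
    and x: "x \<in> carrier (tensor K (tensor K U V) W)"
  shows "g x = h x"
proof (rule tensor_hom_ext[OF tensor_module[OF U V] W P g h _ x])
  note b = bilinearD[OF pure_tensor_bilinear[OF tensor_module[OF U V] W]]
  fix t w assume t: "t \<in> carrier (tensor K U V)" and w: "w \<in> carrier W"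
  have lin: "(\<lambda>t. k (pure_tensor K (tensor K U V) W t w)) \<in> lin_maps K (tensor K U V) P"
    if "k \<in> lin_maps K (tensor K (tensor K U V) W) P" for k
    by (rule lin_mapsI) (use w in \<open>simp_all add: lin_mapsD[OF that] b\<close>)
  show "g (pure_tensor K (tensor K U V) W t w) = h (pure_tensor K (tensor K U V) W t w)"
    by (rule tensor_hom_ext[OF U V P lin[OF g] lin[OF h] _ t]) (use eq w in auto)
qed

lemma tensor_hom_ext3':
  assumes P: "module K P"
    and g: "g \<in> lin_maps K (tensor K U (tensor K V W)) P"
    and h: "h \<in> lin_maps K (tensor K U (tensor K V W)) P"
    and eq: "\<And>u v w. \<lbrakk>u \<in> carrier U; v \<in> carrier V; w \<in> carrier W\<rbrakk> \<Longrightarrow>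
      g (pure_tensor K U (tensor K V W) u (pure_tensor K V W v w)) =
      h (pure_tensor K U (tensor K V W) u (pure_tensor K V W v w))"
    and x: "x \<in> carrier (tensor K U (tensor K V W))"
  shows "g x = h x"
proof (rule tensor_hom_ext[OF U tensor_module[OF V W] P g h _ x])
  note b = bilinearD[OF pure_tensor_bilinear[OF U tensor_module[OF V W]]]
  fix u t assume u: "u \<in> carrier U" and t: "t \<in> carrier (tensor K V W)"
  have lin: "(\<lambda>t. k (pure_tensor K U (tensor K V W) u t)) \<in> lin_maps K (tensor K V W) P"
    if "k \<in> lin_maps K (tensor K U (tensor K V W)) P" for k
    by (rule lin_mapsI) (use u in \<open>simp_all add: lin_mapsD[OF that] b\<close>)
  show "g (pure_tensor K U (tensor K V W) u t) = h (pure_tensor K U (tensor K V W) u t)"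
    by (rule tensor_hom_ext[OF V W P lin[OF g] lin[OF h] _ t]) (use eq u in auto)
qed

lemma tensor_assoc_inverse:
  shows "x \<in> carrier (tensor K (tensor K U V) W) \<Longrightarrow>
      tensor_assoc_inv K U V W (tensor_assoc K U V W x) = x"
    and "y \<in> carrier (tensor K U (tensor K V W)) \<Longrightarrow>
      tensor_assoc K U V W (tensor_assoc_inv K U V W y) = y"
proof -
  note a = lin_mapsD[OF tensor_assoc_linear] and i = lin_mapsD[OF tensor_assoc_inv_linear]
  note T = tensor_module[OF tensor_module[OF U V] W] and T' = tensor_module[OF U tensor_module[OF V W]]
  show "tensor_assoc_inv K U V W (tensor_assoc K U V W x) = x"
    if "x \<in> carrier (tensor K (tensor K U V) W)"
    by (rule tensor_hom_ext3[OF T, of "\<lambda>x. tensor_assoc_inv K U V W (tensor_assoc K U V W x)" "\<lambda>x. x"])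
      (use that in \<open>auto intro!: lin_mapsI simp: a i tensor_assoc_pure tensor_assoc_inv_pure\<close>)
  show "tensor_assoc K U V W (tensor_assoc_inv K U V W y) = y"
    if "y \<in> carrier (tensor K U (tensor K V W))"
    by (rule tensor_hom_ext3'[OF T', of "\<lambda>x. tensor_assoc K U V W (tensor_assoc_inv K U V W x)" "\<lambda>x. x"])
      (use that in \<open>auto intro!: lin_mapsI simp: a i tensor_assoc_pure tensor_assoc_inv_pure\<close>)
qed

end

end

theory Submission
  imports Defs
begin

text \<open>
  Write \<open>a'\<close> for \<open>\<alpha> a\<close>, and let \<open>B\<^sub>1\<^sub>2 = B \<otimes> \<alpha>\<close> and \<open>B\<^sub>2\<^sub>3 = \<alpha> \<otimes> B\<close>. If one
  argument of \<open>B\<close> is the unit, the term \<open>- l (\<alpha> a \<otimes> \<alpha> b)\<close> involves the same tensor as one of the other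
  two terms. In the first case below it cancels, because \<open>ab \<otimes> 1\<close> has the opposite coefficient \<open>l\<close>:

    \<open>B (a \<otimes> 1) = n (1 \<otimes> a')\<close>,  \<open>B (1 \<otimes> a) = l (a' \<otimes> 1) + (n - l) (1 \<otimes> a')\<close>.

  After one application of \<open>B\<close> most tensors do contain a unit, so these two formulas make the
  expansion of both sides of the Hom-Yang-Baxter equation short. Hom-associativity identifies the
  two ways \<open>(ab)'c''\<close> and \<open>a''(bc)'\<close> of multiplying all three factors; call this element \<open>X\<close>. On
  \<open>a \<otimes> b \<otimes> c\<close> both \<open>B\<^sub>1\<^sub>2 B\<^sub>2\<^sub>3 B\<^sub>1\<^sub>2\<close> and \<open>B\<^sub>2\<^sub>3 B\<^sub>1\<^sub>2 B\<^sub>2\<^sub>3\<close> are equal to the sum of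

    \<open>l\<^sup>2 n (X \<otimes> 1 \<otimes> 1) + (l n\<^sup>2 - l\<^sup>2 n) (1 \<otimes> X \<otimes> 1) + n\<^sup>3 (1 \<otimes> 1 \<otimes> X)\<close>,

    \<open>- l\<^sup>3 ((ab)'' \<otimes> c''' \<otimes> 1) + (l\<^sup>3 - l\<^sup>2 n) ((ab)'' \<otimes> 1 \<otimes> c''') + l\<^sup>2 n (1 \<otimes> (ab)'' \<otimes> c''')\<close>,

    \<open>l\<^sup>3 (a''' \<otimes> (bc)'' \<otimes> 1) - l n\<^sup>2 (1 \<otimes> a''' \<otimes> (bc)'') - l\<^sup>3 (a''' \<otimes> b''' \<otimes> c''')\<close>.

  The expansion of the two sides is \<open>braid_pure\<close>, and the comparison of coefficients, a statement
  about ten arbitrary vectors in a module, is \<open>braid_combination\<close>. Linear maps on a tensor product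
  are determined by their values on pure tensors, which gives the equation everywhere. That \<open>B\<close>
  commutes with \<open>\<alpha> \<otimes> \<alpha>\<close> holds because \<open>\<alpha>\<close> is multiplicative and fixes the unit, and \<open>B\<close> exists
  because each of its three terms is a linear map on the tensor product.
\<close>

section \<open>Linear maps and linear combinations\<close>

lemma lin_maps_comp:
  assumes "f \<in> lin_maps K U V" and "g \<in> lin_maps K V W"
  shows "g \<circ> f \<in> lin_maps K U W"
  using assms by (intro lin_mapsI) (simp_all add: lin_mapsD)

text \<open>
  The shape of the combination is that of the values of the Yang-Baxter map, so that a linear map
  can be applied to such a value in one rewriting step.
\<close>

lemma lin_map_combination:
  assumes "module K V" and "module K W" and f: "f \<in> lin_maps K V W"
    and "c \<in> carrier K" "d \<in> carrier K" "e \<in> carrier K"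
    and "x \<in> carrier V" "y \<in> carrier V" "z \<in> carrier V"
  shows "f (c \<odot>\<^bsub>V\<^esub> x \<oplus>\<^bsub>V\<^esub> d \<odot>\<^bsub>V\<^esub> y \<ominus>\<^bsub>V\<^esub> e \<odot>\<^bsub>V\<^esub> z) =
    c \<odot>\<^bsub>W\<^esub> f x \<oplus>\<^bsub>W\<^esub> d \<odot>\<^bsub>W\<^esub> f y \<ominus>\<^bsub>W\<^esub> e \<odot>\<^bsub>W\<^esub> f z"
proof -
  interpret V: module K V by fact
  interpret W: module K W by fact
  show ?thesis
    using assms by (simp add: lin_map_minus[OF assms(1-3)] lin_mapsD[OF f])
qed

lemma lin_maps_combination:
  assumes V: "module K V" and W: "module K W"
    and "f \<in> lin_maps K V W" "g \<in> lin_maps K V W" "h \<in> lin_maps K V W"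
    and "c \<in> carrier K" "d \<in> carrier K" "e \<in> carrier K"
  shows "(\<lambda>x. c \<odot>\<^bsub>W\<^esub> f x \<oplus>\<^bsub>W\<^esub> d \<odot>\<^bsub>W\<^esub> g x \<ominus>\<^bsub>W\<^esub> e \<odot>\<^bsub>W\<^esub> h x) \<in> lin_maps K V W"
proof -
  interpret V: module K V by fact
  interpret W: module K W by fact
  have "(\<lambda>x. c \<odot>\<^bsub>W\<^esub> f x \<oplus>\<^bsub>W\<^esub> d \<odot>\<^bsub>W\<^esub> g x \<oplus>\<^bsub>W\<^esub> (\<ominus>\<^bsub>K\<^esub> e) \<odot>\<^bsub>W\<^esub> h x) \<in> lin_maps K V W"
    using assms by (intro lin_maps_add lin_maps_smult) auto
  moreover have "c \<odot>\<^bsub>W\<^esub> f x \<oplus>\<^bsub>W\<^esub> d \<odot>\<^bsub>W\<^esub> g x \<oplus>\<^bsub>W\<^esub> (\<ominus>\<^bsub>K\<^esub> e) \<odot>\<^bsub>W\<^esub> h x =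
      c \<odot>\<^bsub>W\<^esub> f x \<oplus>\<^bsub>W\<^esub> d \<odot>\<^bsub>W\<^esub> g x \<ominus>\<^bsub>W\<^esub> e \<odot>\<^bsub>W\<^esub> h x" if "x \<in> carrier V" for x
    using that assms by (simp add: a_minus_def W.smult_l_minus lin_mapsD(1))
  ultimately show ?thesis
    unfolding lin_maps_def by (auto simp: Pi_iff)
qed

context module
begin

text \<open>
  Rearranging a sum by associativity and commutativity does not bring together two terms with the
  same vector and different coefficients. With coefficient lists over a fixed list of vectors the
  module operations act entry by entry, and an identity between combinations of these vectors
  becomes a list of ring identities. The coefficients are taken by \<open>hd\<close> and \<open>tl\<close>, so only
  coefficient lists of the length of the vector list are meaningful.
\<close>

primrec lincomb :: "'c list \<Rightarrow> 'a list \<Rightarrow> 'c" where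
  "lincomb [] cs = \<zero>\<^bsub>M\<^esub>"
| "lincomb (x # xs) cs = hd cs \<odot>\<^bsub>M\<^esub> x \<oplus>\<^bsub>M\<^esub> lincomb xs (tl cs)"

lemma lincomb_closed:
  assumes "set xs \<subseteq> carrier M" "set cs \<subseteq> carrier R" "length cs = length xs"
  shows "lincomb xs cs \<in> carrier M"
  using assms(3,1,2) by (induction cs xs rule: list_induct2) auto

lemma lincomb_add:
  assumes "set xs \<subseteq> carrier M" "set cs \<subseteq> carrier R" "set ds \<subseteq> carrier R"
    and "length cs = length ds" "length ds = length xs"
  shows "lincomb xs cs \<oplus>\<^bsub>M\<^esub> lincomb xs ds = lincomb xs (map2 (\<oplus>) cs ds)"
  using assms(4,5,1-3)
proof (induction cs ds xs rule: list_induct3)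
  case (Cons c cs d ds x xs)
  then have "lincomb xs cs \<in> carrier M" "lincomb xs ds \<in> carrier M"
    by (auto intro!: lincomb_closed)
  with Cons show ?case by (simp add: smult_l_distr M.a_ac flip: Cons.IH)
qed simp

lemma lincomb_smult:
  assumes "set xs \<subseteq> carrier M" "set cs \<subseteq> carrier R" "r \<in> carrier R" "length cs = length xs"
  shows "r \<odot>\<^bsub>M\<^esub> lincomb xs cs = lincomb xs (map ((\<otimes>) r) cs)"
  using assms(4,1-3)
  by (induction cs xs rule: list_induct2) (auto simp: smult_r_distr smult_assoc1 lincomb_closed)

lemma lincomb_minus:
  assumes "set xs \<subseteq> carrier M" "set cs \<subseteq> carrier R" "set ds \<subseteq> carrier R"
    and "length cs = length ds" "length ds = length xs"
  shows "lincomb xs cs \<ominus>\<^bsub>M\<^esub> lincomb xs ds = lincomb xs (map2 (\<lambda>c d. c \<ominus> d) cs ds)"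
  using assms(4,5,1-3)
proof (induction cs ds xs rule: list_induct3)
  case (Cons c cs d ds x xs)
  then have "lincomb xs cs \<in> carrier M" "lincomb xs ds \<in> carrier M"
    by (auto intro!: lincomb_closed)
  with Cons show ?case
    by (simp add: smult_l_distr smult_l_minus M.a_ac M.minus_add a_minus_def
        flip: Cons.IH[unfolded a_minus_def])
qed (simp add: a_minus_def)

text \<open>
  The two sides are what repeated expansion of the two sides of the braid relation yields on
  \<open>a \<otimes> b \<otimes> c\<close>. With \<open>X = (ab)'c''\<close> the vectors stand for

    \<open>x, y, z\<close>: \<open>X\<close> in the first, second or third slot and units elsewhere;

    \<open>u1, u2, u3\<close>: \<open>(ab)''\<close> and \<open>c'''\<close> in this order and the unit in slot three, two or one;

    \<open>v1, v2, v3\<close>: \<open>a'''\<close> and \<open>(bc)''\<close> in this order and the unit in slot three, two or one;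

    \<open>w\<close>: \<open>a''' \<otimes> b''' \<otimes> c'''\<close>.

  Each vector has the same coefficient, a cubic form in \<open>l\<close> and \<open>n\<close>, on both sides; that of \<open>v2\<close>,
  which occurs only on the right, is zero.
\<close>

lemma braid_combination:
  assumes "l \<in> carrier R" "n \<in> carrier R"
    and v: "x \<in> carrier M" "y \<in> carrier M" "z \<in> carrier M"
      "u1 \<in> carrier M" "u2 \<in> carrier M" "u3 \<in> carrier M"
      "v1 \<in> carrier M" "v2 \<in> carrier M" "v3 \<in> carrier M" "w \<in> carrier M"
  shows
    "l \<odot>\<^bsub>M\<^esub> (l \<odot>\<^bsub>M\<^esub> (l \<odot>\<^bsub>M\<^esub> x \<oplus>\<^bsub>M\<^esub> n \<odot>\<^bsub>M\<^esub> y \<ominus>\<^bsub>M\<^esub> l \<odot>\<^bsub>M\<^esub> u1)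
        \<oplus>\<^bsub>M\<^esub> (n \<ominus> l) \<odot>\<^bsub>M\<^esub> (n \<odot>\<^bsub>M\<^esub> u3))
      \<oplus>\<^bsub>M\<^esub> n \<odot>\<^bsub>M\<^esub> (l \<odot>\<^bsub>M\<^esub> (l \<odot>\<^bsub>M\<^esub> x \<oplus>\<^bsub>M\<^esub> (n \<ominus> l) \<odot>\<^bsub>M\<^esub> y)
        \<oplus>\<^bsub>M\<^esub> n \<odot>\<^bsub>M\<^esub> (n \<odot>\<^bsub>M\<^esub> z)
        \<ominus>\<^bsub>M\<^esub> l \<odot>\<^bsub>M\<^esub> (l \<odot>\<^bsub>M\<^esub> u2 \<oplus>\<^bsub>M\<^esub> (n \<ominus> l) \<odot>\<^bsub>M\<^esub> u3))
      \<ominus>\<^bsub>M\<^esub> l \<odot>\<^bsub>M\<^esub> (l \<odot>\<^bsub>M\<^esub> (l \<odot>\<^bsub>M\<^esub> x \<oplus>\<^bsub>M\<^esub> n \<odot>\<^bsub>M\<^esub> y \<ominus>\<^bsub>M\<^esub> l \<odot>\<^bsub>M\<^esub> v1)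
        \<oplus>\<^bsub>M\<^esub> n \<odot>\<^bsub>M\<^esub> (n \<odot>\<^bsub>M\<^esub> v3)
        \<ominus>\<^bsub>M\<^esub> l \<odot>\<^bsub>M\<^esub> (l \<odot>\<^bsub>M\<^esub> u2 \<oplus>\<^bsub>M\<^esub> n \<odot>\<^bsub>M\<^esub> u3 \<ominus>\<^bsub>M\<^esub> l \<odot>\<^bsub>M\<^esub> w)) =
     l \<odot>\<^bsub>M\<^esub> (l \<odot>\<^bsub>M\<^esub> (n \<odot>\<^bsub>M\<^esub> x) \<oplus>\<^bsub>M\<^esub> n \<odot>\<^bsub>M\<^esub> (n \<odot>\<^bsub>M\<^esub> z)
        \<ominus>\<^bsub>M\<^esub> l \<odot>\<^bsub>M\<^esub> (n \<odot>\<^bsub>M\<^esub> v2))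
      \<oplus>\<^bsub>M\<^esub> n \<odot>\<^bsub>M\<^esub> (n \<odot>\<^bsub>M\<^esub> (l \<odot>\<^bsub>M\<^esub> y \<oplus>\<^bsub>M\<^esub> n \<odot>\<^bsub>M\<^esub> z \<ominus>\<^bsub>M\<^esub> l \<odot>\<^bsub>M\<^esub> v3))
      \<ominus>\<^bsub>M\<^esub> l \<odot>\<^bsub>M\<^esub> (l \<odot>\<^bsub>M\<^esub> (l \<odot>\<^bsub>M\<^esub> u1 \<oplus>\<^bsub>M\<^esub> (n \<ominus> l) \<odot>\<^bsub>M\<^esub> u2)
        \<oplus>\<^bsub>M\<^esub> n \<odot>\<^bsub>M\<^esub> (l \<odot>\<^bsub>M\<^esub> y \<oplus>\<^bsub>M\<^esub> n \<odot>\<^bsub>M\<^esub> z \<ominus>\<^bsub>M\<^esub> l \<odot>\<^bsub>M\<^esub> u3)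
        \<ominus>\<^bsub>M\<^esub> l \<odot>\<^bsub>M\<^esub> (l \<odot>\<^bsub>M\<^esub> v1 \<oplus>\<^bsub>M\<^esub> n \<odot>\<^bsub>M\<^esub> v2 \<ominus>\<^bsub>M\<^esub> l \<odot>\<^bsub>M\<^esub> w))"
proof -
  define E where "E = [x, y, z, u1, u2, u3, v1, v2, v3, w]"
  have E: "set E \<subseteq> carrier M" "length E = 10" using v by (simp_all add: E_def)
  have basis:
    "x = lincomb E [\<one>, \<zero>, \<zero>, \<zero>, \<zero>, \<zero>, \<zero>, \<zero>, \<zero>, \<zero>]"
    "y = lincomb E [\<zero>, \<one>, \<zero>, \<zero>, \<zero>, \<zero>, \<zero>, \<zero>, \<zero>, \<zero>]"
    "z = lincomb E [\<zero>, \<zero>, \<one>, \<zero>, \<zero>, \<zero>, \<zero>, \<zero>, \<zero>, \<zero>]"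
    "u1 = lincomb E [\<zero>, \<zero>, \<zero>, \<one>, \<zero>, \<zero>, \<zero>, \<zero>, \<zero>, \<zero>]"
    "u2 = lincomb E [\<zero>, \<zero>, \<zero>, \<zero>, \<one>, \<zero>, \<zero>, \<zero>, \<zero>, \<zero>]"
    "u3 = lincomb E [\<zero>, \<zero>, \<zero>, \<zero>, \<zero>, \<one>, \<zero>, \<zero>, \<zero>, \<zero>]"
    "v1 = lincomb E [\<zero>, \<zero>, \<zero>, \<zero>, \<zero>, \<zero>, \<one>, \<zero>, \<zero>, \<zero>]"
    "v2 = lincomb E [\<zero>, \<zero>, \<zero>, \<zero>, \<zero>, \<zero>, \<zero>, \<one>, \<zero>, \<zero>]"
    "v3 = lincomb E [\<zero>, \<zero>, \<zero>, \<zero>, \<zero>, \<zero>, \<zero>, \<zero>, \<one>, \<zero>]"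
    "w = lincomb E [\<zero>, \<zero>, \<zero>, \<zero>, \<zero>, \<zero>, \<zero>, \<zero>, \<zero>, \<one>]"
    using v by (simp_all add: E_def)
  show ?thesis
    unfolding basis
    using assms(1,2) E
    by (simp add: lincomb_smult lincomb_add lincomb_minus, intro arg_cong[where f = "lincomb E"], simp)
      (intro conjI; algebra)
qed

end

section \<open>The braid relation on pure tensors\<close>

context hom_algebra
begin

abbreviation AA where "AA \<equiv> tensor K A A"
abbreviation AAA where "AAA \<equiv> tensor K AA A"
abbreviation t where "t \<equiv> pure_tensor K A A"
abbreviation t3 where "t3 a b c \<equiv> pure_tensor K AA A (t a b) c"
abbreviation mul (infixl "\<cdot>" 75) where "a \<cdot> b \<equiv> \<mu> (t a b)"

lemma module_A: "module K A" by (rule module_axioms)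
lemma module_AA: "module K AA" by (intro tensor_module module_A)
lemma module_AAA: "module K AAA" by (intro tensor_module module_A module_AA)

lemmas t_bilinear = bilinearD[OF pure_tensor_bilinear[OF module_A module_A]]
lemmas t3_bilinear = bilinearD[OF pure_tensor_bilinear[OF module_AA module_A]]
lemmas t3'_bilinear = bilinearD[OF pure_tensor_bilinear[OF module_A module_AA]]
lemmas alpha_simps = lin_mapsD[OF alpha_linear]

lemma mul_closed: "\<lbrakk>a \<in> carrier A; b \<in> carrier A\<rbrakk> \<Longrightarrow> a \<cdot> b \<in> carrier A"
  by (simp add: lin_mapsD(1)[OF mu_linear] t_bilinear)

lemmas closed = mul_closed unit_closed alpha_simps(1) t_bilinear(1) t3_bilinear(1)

lemma yb_map_exists:
  assumes ln: "l \<in> carrier K" "n \<in> carrier K"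
  shows "\<exists>B. is_yb_map K A \<mu> unit \<alpha> l n B"
proof -
  have m1: "(\<lambda>x. t (\<mu> x) unit) \<in> lin_maps K AA AA" and m2: "(\<lambda>x. t unit (\<mu> x)) \<in> lin_maps K AA AA"
    by (rule lin_mapsI; simp add: lin_mapsD[OF mu_linear] t_bilinear unit_closed)+
  note aa = tensor_map[OF module_A module_A module_A module_A alpha_linear alpha_linear]
  show ?thesis
    unfolding is_yb_map_def Let_def
    by (rule exI, rule conjI,
        rule lin_maps_combination[OF module_AA module_AA m1 m2 aa(1) ln ln(1)])
      (simp add: aa)
qed

end

locale yb_map = hom_algebra K A \<mu> unit \<alpha>
  for K :: "('k, 'm) ring_scheme" (structure) and A :: "('k, 'a, 'n) module_scheme" (structure)
    and \<mu> unit \<alpha> +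
  fixes l n :: 'k and B
  assumes l: "l \<in> carrier K" and n: "n \<in> carrier K" and yb: "is_yb_map K A \<mu> unit \<alpha> l n B"
begin

lemma B_linear: "B \<in> lin_maps K AA AA"
  using yb by (simp add: is_yb_map_def Let_def)

lemma B_pure:
  "\<lbrakk>a \<in> carrier A; b \<in> carrier A\<rbrakk> \<Longrightarrow>
    B (t a b) = l \<odot>\<^bsub>AA\<^esub> t (a \<cdot> b) unit \<oplus>\<^bsub>AA\<^esub> n \<odot>\<^bsub>AA\<^esub> t unit (a \<cdot> b) \<ominus>\<^bsub>AA\<^esub> l \<odot>\<^bsub>AA\<^esub> t (\<alpha> a) (\<alpha> b)"
  using yb by (simp add: is_yb_map_def Let_def)

text \<open>
  The maps \<open>B \<otimes> \<alpha>\<close> and \<open>\<alpha> \<otimes> B\<close> on \<open>(A \<otimes> A) \<otimes> A\<close>, indexed by the slots on which \<open>B\<close> acts.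
\<close>

definition B12 where "B12 = tensor_map K AA A AA A B \<alpha>"
definition B23 where
  "B23 = tensor_assoc_inv K A A A \<circ> tensor_map K A AA A AA \<alpha> B \<circ> tensor_assoc K A A A"

lemma B12_linear: "B12 \<in> lin_maps K AAA AAA"
  unfolding B12_def by (intro tensor_map_linear module_AA module_A B_linear alpha_linear)

lemma B23_linear: "B23 \<in> lin_maps K AAA AAA"
  unfolding B23_def
  by (intro lin_maps_comp[where V = "tensor K A AA"] tensor_assoc_linear tensor_assoc_inv_linear
      tensor_map_linear module_A module_AA B_linear alpha_linear)

lemma B12_pure:
  assumes "a \<in> carrier A" "b \<in> carrier A" "c \<in> carrier A"
  shows "B12 (t3 a b c) = l \<odot>\<^bsub>AAA\<^esub> t3 (a \<cdot> b) unit (\<alpha> c)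
    \<oplus>\<^bsub>AAA\<^esub> n \<odot>\<^bsub>AAA\<^esub> t3 unit (a \<cdot> b) (\<alpha> c) \<ominus>\<^bsub>AAA\<^esub> l \<odot>\<^bsub>AAA\<^esub> t3 (\<alpha> a) (\<alpha> b) (\<alpha> c)"
proof -
  have lin: "(\<lambda>s. pure_tensor K AA A s (\<alpha> c)) \<in> lin_maps K AA AAA"
    using assms by (intro lin_mapsI) (simp_all add: t3_bilinear closed)
  have "B12 (t3 a b c) = pure_tensor K AA A (B (t a b)) (\<alpha> c)"
    unfolding B12_def
    using assms by (intro tensor_map_pure module_A module_AA B_linear alpha_linear) (auto simp: closed)
  then show ?thesis
    using assms l n lin_map_combination[OF module_AA module_AAA lin] by (simp add: B_pure closed)
qed

lemma B23_pure:
  assumes "a \<in> carrier A" "b \<in> carrier A" "c \<in> carrier A"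
  shows "B23 (t3 a b c) = l \<odot>\<^bsub>AAA\<^esub> t3 (\<alpha> a) (b \<cdot> c) unit
    \<oplus>\<^bsub>AAA\<^esub> n \<odot>\<^bsub>AAA\<^esub> t3 (\<alpha> a) unit (b \<cdot> c) \<ominus>\<^bsub>AAA\<^esub> l \<odot>\<^bsub>AAA\<^esub> t3 (\<alpha> a) (\<alpha> b) (\<alpha> c)"
proof -
  let ?f = "\<lambda>s. tensor_assoc_inv K A A A (pure_tensor K A AA (\<alpha> a) s)"
  note inv = tensor_assoc_inv[OF module_A module_A module_A]
  have lin: "?f \<in> lin_maps K AA AAA"
    using assms by (intro lin_mapsI) (simp_all add: t3'_bilinear closed lin_mapsD[OF inv(1)])
  have "B23 (t3 a b c) = ?f (B (t b c))"
    unfolding B23_def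
    using assms
    by (simp add: tensor_assoc_pure[OF module_A module_A module_A] closed
        tensor_map_pure[OF module_A module_AA module_A module_AA alpha_linear B_linear])
  then show ?thesis
    using assms l n lin_map_combination[OF module_AA module_AAA lin] by (simp add: B_pure closed inv)
qed

interpretation T: module K AAA by (rule module_AAA)

lemma cancel_coefficients:
  assumes "u \<in> carrier AAA" "v \<in> carrier AAA"
  shows "l \<odot>\<^bsub>AAA\<^esub> u \<oplus>\<^bsub>AAA\<^esub> n \<odot>\<^bsub>AAA\<^esub> v \<ominus>\<^bsub>AAA\<^esub> l \<odot>\<^bsub>AAA\<^esub> u = n \<odot>\<^bsub>AAA\<^esub> v"
    and "l \<odot>\<^bsub>AAA\<^esub> u \<oplus>\<^bsub>AAA\<^esub> n \<odot>\<^bsub>AAA\<^esub> v \<ominus>\<^bsub>AAA\<^esub> l \<odot>\<^bsub>AAA\<^esub> v =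
      l \<odot>\<^bsub>AAA\<^esub> u \<oplus>\<^bsub>AAA\<^esub> (n \<ominus> l) \<odot>\<^bsub>AAA\<^esub> v"
proof -
  show "l \<odot>\<^bsub>AAA\<^esub> u \<oplus>\<^bsub>AAA\<^esub> n \<odot>\<^bsub>AAA\<^esub> v \<ominus>\<^bsub>AAA\<^esub> l \<odot>\<^bsub>AAA\<^esub> u = n \<odot>\<^bsub>AAA\<^esub> v"
    using assms l n
    by (simp add: T.M.a_comm[of "l \<odot>\<^bsub>AAA\<^esub> u" "n \<odot>\<^bsub>AAA\<^esub> v"] a_minus_def T.M.a_assoc T.M.r_neg)
  show "l \<odot>\<^bsub>AAA\<^esub> u \<oplus>\<^bsub>AAA\<^esub> n \<odot>\<^bsub>AAA\<^esub> v \<ominus>\<^bsub>AAA\<^esub> l \<odot>\<^bsub>AAA\<^esub> v =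
      l \<odot>\<^bsub>AAA\<^esub> u \<oplus>\<^bsub>AAA\<^esub> (n \<ominus> l) \<odot>\<^bsub>AAA\<^esub> v"
    using assms l n by (simp add: a_minus_def T.smult_l_distr T.smult_l_minus T.M.a_assoc)
qed

text \<open>
  If one of the two arguments of \<open>B\<close> is the unit, its product with the other argument \<open>a\<close> is
  \<open>\<alpha> a\<close>, so two of the three terms of \<open>B\<close> involve the same tensor: for \<open>B (a \<otimes> 1)\<close> the terms with
  coefficients \<open>l\<close> and \<open>- l\<close>, which cancel, and for \<open>B (1 \<otimes> a)\<close> those with \<open>n\<close> and \<open>- l\<close>.
\<close>

lemma
  assumes "a \<in> carrier A" "b \<in> carrier A"
  shows B12_unit_right: "B12 (t3 a unit b) = n \<odot>\<^bsub>AAA\<^esub> t3 unit (\<alpha> a) (\<alpha> b)"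
    and B23_unit_right: "B23 (t3 a b unit) = n \<odot>\<^bsub>AAA\<^esub> t3 (\<alpha> a) unit (\<alpha> b)"
    and B12_unit_left: "B12 (t3 unit a b) =
      l \<odot>\<^bsub>AAA\<^esub> t3 (\<alpha> a) unit (\<alpha> b) \<oplus>\<^bsub>AAA\<^esub> (n \<ominus> l) \<odot>\<^bsub>AAA\<^esub> t3 unit (\<alpha> a) (\<alpha> b)"
    and B23_unit_left: "B23 (t3 a unit b) =
      l \<odot>\<^bsub>AAA\<^esub> t3 (\<alpha> a) (\<alpha> b) unit \<oplus>\<^bsub>AAA\<^esub> (n \<ominus> l) \<odot>\<^bsub>AAA\<^esub> t3 (\<alpha> a) unit (\<alpha> b)"
  using assms
  by (simp_all add: B12_pure B23_pure closed alpha_unit mult_unit_left mult_unit_right cancel_coefficients)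

text \<open>
  Both sides are expanded innermost map first. Where \<open>B\<close> meets a unit, the short formulas above
  replace the general one, and \<open>B (1 \<otimes> 1)\<close> is taken as the value \<open>n (1 \<otimes> 1)\<close> of \<open>B (a \<otimes> 1)\<close>, which has
  fewer terms than the equal value of \<open>B (1 \<otimes> a)\<close>. Only the identification of the two three-fold
  products uses Hom-associativity; the other products match because \<open>\<alpha>\<close> is multiplicative.
\<close>

lemma braid_pure:
  assumes abc: "a \<in> carrier A" "b \<in> carrier A" "c \<in> carrier A"
  shows "B23 (B12 (B23 (t3 a b c))) = B12 (B23 (B12 (t3 a b c)))"
proof -
  \<comment> \<open>The index counts the twists that have been applied; \<open>r\<close> is \<open>(ab)c' = a'(bc)\<close>, and
    \<open>r1\<close> is the element \<open>X\<close>.\<close>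
  define a1 b1 c1 where tw1: "a1 = \<alpha> a" "b1 = \<alpha> b" "c1 = \<alpha> c"
  define a2 b2 c2 where tw2: "a2 = \<alpha> a1" "b2 = \<alpha> b1" "c2 = \<alpha> c1"
  define p p1 q q1 where pq: "p = a \<cdot> b" "p1 = a1 \<cdot> b1" "q = b \<cdot> c" "q1 = b1 \<cdot> c1"
  define r r1 where r: "r = p \<cdot> c1" "r1 = p1 \<cdot> c2"
  note cl = abc tw1 tw2 pq r closed
  have [simp]: "a1 \<in> carrier A" "b1 \<in> carrier A" "c1 \<in> carrier A"
    "a2 \<in> carrier A" "b2 \<in> carrier A" "c2 \<in> carrier A" "p \<in> carrier A" "p1 \<in> carrier A"
    "q \<in> carrier A" "q1 \<in> carrier A" "r \<in> carrier A" "r1 \<in> carrier A"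
    by (simp_all add: cl)
  have q: "a1 \<cdot> q = r" "a2 \<cdot> q1 = r1"
    unfolding r pq tw2 using abc by (simp_all add: tw1 hom_assoc closed)
  have al: "\<alpha> p = p1" "\<alpha> q = q1" "\<alpha> r = r1" "a2 \<cdot> b2 = \<alpha> p1" "b2 \<cdot> c2 = \<alpha> q1"
    unfolding r pq tw2 using abc by (simp_all add: tw1 alpha_mult closed)
  note lin = lin_map_combination[OF module_AAA module_AAA B12_linear]
    lin_map_combination[OF module_AAA module_AAA B23_linear]
    lin_mapsD[OF B12_linear] lin_mapsD[OF B23_linear]
  \<comment> \<open>Folding the definitions keeps every factor in the form in which the instances below match it.\<close>
  note simps = l n abc lin closed alpha_unit al q tw1[symmetric] tw2[symmetric]
    pq[symmetric] r[symmetric]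
  have "B23 (B12 (t3 a b c)) =
      l \<odot>\<^bsub>AAA\<^esub> (l \<odot>\<^bsub>AAA\<^esub> t3 p1 c2 unit \<oplus>\<^bsub>AAA\<^esub> (n \<ominus> l) \<odot>\<^bsub>AAA\<^esub> t3 p1 unit c2)
      \<oplus>\<^bsub>AAA\<^esub> n \<odot>\<^bsub>AAA\<^esub> (l \<odot>\<^bsub>AAA\<^esub> t3 unit r unit \<oplus>\<^bsub>AAA\<^esub> n \<odot>\<^bsub>AAA\<^esub> t3 unit unit r
        \<ominus>\<^bsub>AAA\<^esub> l \<odot>\<^bsub>AAA\<^esub> t3 unit p1 c2)
      \<ominus>\<^bsub>AAA\<^esub> l \<odot>\<^bsub>AAA\<^esub> (l \<odot>\<^bsub>AAA\<^esub> t3 a2 q1 unit \<oplus>\<^bsub>AAA\<^esub> n \<odot>\<^bsub>AAA\<^esub> t3 a2 unit q1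
        \<ominus>\<^bsub>AAA\<^esub> l \<odot>\<^bsub>AAA\<^esub> t3 a2 b2 c2)"
    by (simp add: simps B12_pure[of a b c] B23_unit_left[of p c1] B23_pure[of unit p c1]
        B23_pure[of a1 b1 c1])
  then have 121: "B12 (B23 (B12 (t3 a b c))) =
      l \<odot>\<^bsub>AAA\<^esub> (l \<odot>\<^bsub>AAA\<^esub> (l \<odot>\<^bsub>AAA\<^esub> t3 r1 unit unit \<oplus>\<^bsub>AAA\<^esub> n \<odot>\<^bsub>AAA\<^esub> t3 unit r1 unit
          \<ominus>\<^bsub>AAA\<^esub> l \<odot>\<^bsub>AAA\<^esub> t3 (\<alpha> p1) (\<alpha> c2) unit)
        \<oplus>\<^bsub>AAA\<^esub> (n \<ominus> l) \<odot>\<^bsub>AAA\<^esub> (n \<odot>\<^bsub>AAA\<^esub> t3 unit (\<alpha> p1) (\<alpha> c2)))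
      \<oplus>\<^bsub>AAA\<^esub> n \<odot>\<^bsub>AAA\<^esub> (l \<odot>\<^bsub>AAA\<^esub> (l \<odot>\<^bsub>AAA\<^esub> t3 r1 unit unit \<oplus>\<^bsub>AAA\<^esub> (n \<ominus> l) \<odot>\<^bsub>AAA\<^esub> t3 unit r1 unit)
        \<oplus>\<^bsub>AAA\<^esub> n \<odot>\<^bsub>AAA\<^esub> (n \<odot>\<^bsub>AAA\<^esub> t3 unit unit r1)
        \<ominus>\<^bsub>AAA\<^esub> l \<odot>\<^bsub>AAA\<^esub> (l \<odot>\<^bsub>AAA\<^esub> t3 (\<alpha> p1) unit (\<alpha> c2)
          \<oplus>\<^bsub>AAA\<^esub> (n \<ominus> l) \<odot>\<^bsub>AAA\<^esub> t3 unit (\<alpha> p1) (\<alpha> c2)))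
      \<ominus>\<^bsub>AAA\<^esub> l \<odot>\<^bsub>AAA\<^esub> (l \<odot>\<^bsub>AAA\<^esub> (l \<odot>\<^bsub>AAA\<^esub> t3 r1 unit unit \<oplus>\<^bsub>AAA\<^esub> n \<odot>\<^bsub>AAA\<^esub> t3 unit r1 unit
          \<ominus>\<^bsub>AAA\<^esub> l \<odot>\<^bsub>AAA\<^esub> t3 (\<alpha> a2) (\<alpha> q1) unit)
        \<oplus>\<^bsub>AAA\<^esub> n \<odot>\<^bsub>AAA\<^esub> (n \<odot>\<^bsub>AAA\<^esub> t3 unit (\<alpha> a2) (\<alpha> q1))
        \<ominus>\<^bsub>AAA\<^esub> l \<odot>\<^bsub>AAA\<^esub> (l \<odot>\<^bsub>AAA\<^esub> t3 (\<alpha> p1) unit (\<alpha> c2) \<oplus>\<^bsub>AAA\<^esub> n \<odot>\<^bsub>AAA\<^esub> t3 unit (\<alpha> p1) (\<alpha> c2)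
          \<ominus>\<^bsub>AAA\<^esub> l \<odot>\<^bsub>AAA\<^esub> t3 (\<alpha> a2) (\<alpha> b2) (\<alpha> c2)))"
    by (simp add: simps B12_pure[of p1 c2 unit] B12_unit_right B12_unit_left[of r unit]
        B12_unit_left[of p1 c2] B12_pure[of a2 q1 unit] B12_pure[of a2 b2 c2])
  have "B12 (B23 (t3 a b c)) =
      l \<odot>\<^bsub>AAA\<^esub> (l \<odot>\<^bsub>AAA\<^esub> t3 r unit unit \<oplus>\<^bsub>AAA\<^esub> n \<odot>\<^bsub>AAA\<^esub> t3 unit r unit
        \<ominus>\<^bsub>AAA\<^esub> l \<odot>\<^bsub>AAA\<^esub> t3 a2 q1 unit)
      \<oplus>\<^bsub>AAA\<^esub> n \<odot>\<^bsub>AAA\<^esub> (n \<odot>\<^bsub>AAA\<^esub> t3 unit a2 q1)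
      \<ominus>\<^bsub>AAA\<^esub> l \<odot>\<^bsub>AAA\<^esub> (l \<odot>\<^bsub>AAA\<^esub> t3 p1 unit c2 \<oplus>\<^bsub>AAA\<^esub> n \<odot>\<^bsub>AAA\<^esub> t3 unit p1 c2
        \<ominus>\<^bsub>AAA\<^esub> l \<odot>\<^bsub>AAA\<^esub> t3 a2 b2 c2)"
    by (simp add: simps B23_pure[of a b c] B12_pure[of a1 q unit] B12_unit_right[of a1 q]
        B12_pure[of a1 b1 c1])
  then have 212: "B23 (B12 (B23 (t3 a b c))) =
      l \<odot>\<^bsub>AAA\<^esub> (l \<odot>\<^bsub>AAA\<^esub> (n \<odot>\<^bsub>AAA\<^esub> t3 r1 unit unit) \<oplus>\<^bsub>AAA\<^esub> n \<odot>\<^bsub>AAA\<^esub> (n \<odot>\<^bsub>AAA\<^esub> t3 unit unit r1)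
        \<ominus>\<^bsub>AAA\<^esub> l \<odot>\<^bsub>AAA\<^esub> (n \<odot>\<^bsub>AAA\<^esub> t3 (\<alpha> a2) unit (\<alpha> q1)))
      \<oplus>\<^bsub>AAA\<^esub> n \<odot>\<^bsub>AAA\<^esub> (n \<odot>\<^bsub>AAA\<^esub> (l \<odot>\<^bsub>AAA\<^esub> t3 unit r1 unit \<oplus>\<^bsub>AAA\<^esub> n \<odot>\<^bsub>AAA\<^esub> t3 unit unit r1
        \<ominus>\<^bsub>AAA\<^esub> l \<odot>\<^bsub>AAA\<^esub> t3 unit (\<alpha> a2) (\<alpha> q1)))
      \<ominus>\<^bsub>AAA\<^esub> l \<odot>\<^bsub>AAA\<^esub> (l \<odot>\<^bsub>AAA\<^esub> (l \<odot>\<^bsub>AAA\<^esub> t3 (\<alpha> p1) (\<alpha> c2) unit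
          \<oplus>\<^bsub>AAA\<^esub> (n \<ominus> l) \<odot>\<^bsub>AAA\<^esub> t3 (\<alpha> p1) unit (\<alpha> c2))
        \<oplus>\<^bsub>AAA\<^esub> n \<odot>\<^bsub>AAA\<^esub> (l \<odot>\<^bsub>AAA\<^esub> t3 unit r1 unit \<oplus>\<^bsub>AAA\<^esub> n \<odot>\<^bsub>AAA\<^esub> t3 unit unit r1
          \<ominus>\<^bsub>AAA\<^esub> l \<odot>\<^bsub>AAA\<^esub> t3 unit (\<alpha> p1) (\<alpha> c2))
        \<ominus>\<^bsub>AAA\<^esub> l \<odot>\<^bsub>AAA\<^esub> (l \<odot>\<^bsub>AAA\<^esub> t3 (\<alpha> a2) (\<alpha> q1) unit \<oplus>\<^bsub>AAA\<^esub> n \<odot>\<^bsub>AAA\<^esub> t3 (\<alpha> a2) unit (\<alpha> q1)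
          \<ominus>\<^bsub>AAA\<^esub> l \<odot>\<^bsub>AAA\<^esub> t3 (\<alpha> a2) (\<alpha> b2) (\<alpha> c2)))"
    by (simp add: simps B23_unit_right B23_unit_left[of p1 c2] B23_pure[of unit a2 q1]
        B23_pure[of unit p1 c2] B23_pure[of a2 b2 c2])
  show ?thesis
    unfolding 121 212 by (rule T.braid_combination[symmetric]) (simp_all add: l n closed)
qed

lemma hybe: "hybe_solution K A \<alpha> B"
proof -
  note aa = tensor_map[OF module_A module_A module_A module_A alpha_linear alpha_linear]
  let ?aa = "tensor_map K A A A A \<alpha> \<alpha>"
  have "(?aa \<circ> B) x = (B \<circ> ?aa) x" if "x \<in> carrier AA" for x
  proof (rule tensor_hom_ext[OF module_A module_A module_AA _ _ _ that])
    show "?aa \<circ> B \<in> lin_maps K AA AA" "B \<circ> ?aa \<in> lin_maps K AA AA"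
      by (rule lin_maps_comp B_linear aa)+
    show "(?aa \<circ> B) (t a b) = (B \<circ> ?aa) (t a b)" if "a \<in> carrier A" "b \<in> carrier A" for a b
      using that l n
      by (simp add: aa(2) B_pure closed lin_map_combination[OF module_AA module_AA aa(1)]
          alpha_unit alpha_mult)
  qed
  moreover have "(B23 \<circ> B12 \<circ> B23) x = (B12 \<circ> B23 \<circ> B12) x" if "x \<in> carrier AAA" for x
  proof (rule tensor_hom_ext3[OF module_A module_A module_A module_AAA _ _ _ that])
    show "B23 \<circ> B12 \<circ> B23 \<in> lin_maps K AAA AAA" "B12 \<circ> B23 \<circ> B12 \<in> lin_maps K AAA AAA"
      by (rule lin_maps_comp B12_linear B23_linear)+
  qed (simp add: braid_pure)
  ultimately show ?thesis
    unfolding hybe_solution_def Let_def using B_linear by (simp add: B12_def B23_def)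
qed

end

theorem theorem2p1:
  fixes K :: "('k, 'm) ring_scheme" and A :: "('k, 'a, 'n) module_scheme"
    and \<mu> :: "('a \<times> 'a \<Rightarrow> 'k) set \<Rightarrow> 'a" and unit :: 'a and \<alpha> :: "'a \<Rightarrow> 'a"
    and l n :: 'k
  assumes "hom_algebra K A \<mu> unit \<alpha>"
    and "l \<in> carrier K" and "n \<in> carrier K"
  shows "(\<exists>B. is_yb_map K A \<mu> unit \<alpha> l n B) \<and>
         (\<forall>B. is_yb_map K A \<mu> unit \<alpha> l n B \<longrightarrow> hybe_solution K A \<alpha> B)"
proof (intro conjI allI impI)
  show "\<exists>B. is_yb_map K A \<mu> unit \<alpha> l n B"
    using assms by (rule hom_algebra.yb_map_exists)
  fix B assume "is_yb_map K A \<mu> unit \<alpha> l n B"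
  then interpret yb_map K A \<mu> unit \<alpha> l n B
    using assms by (simp add: yb_map_def yb_map_axioms_def)
  show "hybe_solution K A \<alpha> B" by (rule hybe)
qed

end
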